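(* Let $\mu\neq 0$. For any $\sigma^{(0)}\in\mathbf{C}$ with $\sigma^{(0)}\notin(-\infty,0)\cup[1,+\infty)$, for any $a^{(0)}\in\mathbf{C}$, $a^{(0)}\neq 0$, for any $\theta_1,\theta_2\in\mathbf{R}$ and for any $0<\tilde\sigma<1$, there exists a sufficiently small positive $\epsilon$ and a small positive number $\delta$ such that the equation $PVI_\mu$ has a solution $$y(x;\sigma^{(0)},a^{(0)})=a(x)\,x^{1-\sigma^{(0)}}\bigl(1+O(|x|^{\delta})\bigr),\qquad 0<\delta<1,$$ as $x\to 0$ along the paths $$|x|\le|x_0|<\epsilon,\qquad \arg x=\arg x_0+\frac{\Re\sigma^{(0)}-\Sigma}{\Im\sigma^{(0)}}\ln\frac{|x|}{|x_0|},\qquad 0\le\Sigma\le\tilde\sigma,\qquad (\ast)$$ in the domain $D(\epsilon;\sigma^{(0)};\theta_1,\theta_2,\tilde\sigma)$ defined for non-real $\sigma^{(0)}$, or along any regular path in the domain $D(\epsilon;\sigma^{(0)})$ defined for real $0\le\sigma^{(0)}<1$. The amplitude $a(x)$ is $$a(x):=a^{(0)}\qquad\text{for }0<\Sigma\le\tilde\sigma,\text{ or for real }\sigma^{(0)},$$ $$a(x):=a^{(0)}\left(1+\frac{1}{2a^{(0)}}\,|x_0^{\sigma^{(0)}}|\,e^{i\alpha(x)}+\frac{1}{16[a^{(0)}]^2}\,|x_0^{\sigma^{(0)}}|^2e^{2i\alpha(x)}\right)=O(1)\qquad\text{for }\Sigma=0,$$ where $\alpha(x)$ denotes the real phase of $x^{\sigma^{(0)}}$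 when $\Sigma=0$, that is $x^{\sigma^{(0)}}=|x^{\sigma^{(0)}}|\,e^{i\alpha(x)}\equiv|x_0^{\sigma^{(0)}}|\,e^{i\alpha(x)}$.
   Context: $PVI_\mu$, $\mu\in\mathbf{C}$, is the sixth Painlev\'e equation $$\frac{d^2y}{dx^2}=\frac12\left[\frac1y+\frac1{y-1}+\frac1{y-x}\right]\left(\frac{dy}{dx}\right)^2-\left[\frac1x+\frac1{x-1}+\frac1{y-x}\right]\frac{dy}{dx}+\frac12\frac{y(y-1)(y-x)}{x^2(x-1)^2}\left[(2\mu-1)^2+\frac{x(x-1)}{(y-x)^2}\right].$$ Near $x=0$, $x$ is regarded as a point of the universal covering $\widetilde{\mathbf{C}_0}$ of $\mathbf{C}_0=\mathbf{C}\setminus\{0\}$, so that $x=|x|e^{i\arg x}$ with $-\infty<\arg x<+\infty$. Domains: for non-real $\sigma^{(0)}$, $$D(\epsilon;\sigma^{(0)};\theta_1,\theta_2,\tilde\sigma):=\{x\in\widetilde{\mathbf{C}_0}:\ |x|<\epsilon,\ e^{-\theta_1\Im\sigma^{(0)}}|x|^{\tilde\sigma}\le|x^{\sigma^{(0)}}|\le e^{-\theta_2\Im\sigma^{(0)}}\},\qquad 0<\tilde\sigma<1;$$ for real $0\le\sigma^{(0)}<1$, $$D(\epsilon;\sigma^{(0)}):=\{x\in\widetilde{\mathbf{C}_0}:\ |x|<\epsilon\}.$$ The paths $(\ast)$ are considered when $\Im\sigma^{(0)}\neq0$; they start at some point $x_0$ belonging to the domain, and the condition $0\le\Sigma\le\tilde\sigma$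 ensures that they remain in the domain as $x\to0$; in general they are spirals. When $\Im\sigma^{(0)}=0$ any regular path is allowed (the term "regular path" is used without further specification).
   Formalization: For Σ=0 and |x_0^σ|=4|a| the claim is y=x^{1-σ}(a(x)+O(|x|^δ)), since a(x) has zeros; for Σ>0 the exponent is min(δ,Σ), as the omitted term has order |x|^Σ; PVI is imposed only where y≠0,1,x, so for σ=0, a=1 the degenerate y=x is allowed. *)

theory Defs
  imports "HOL-Complex_Analysis.Complex_Analysis" "HOL-Library.Landau_Symbols"
begin

text \<open>
  The universal covering of the punctured plane is modelled by the plane itself with covering map
  \<^term>\<open>exp\<close>: a point \<open>s\<close> lies over \<open>x = exp s\<close>, with \<open>|x| = exp (Re s)\<close>, \<open>arg x = Im s\<close>
  (unrestricted) and \<open>x\<close> to the power \<open>c\<close> equal to \<open>exp (c * s)\<close>.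
\<close>

type_synonym cover = complex

definition cproj :: "cover \<Rightarrow> complex" where
  "cproj s = exp s"

definition cabs :: "cover \<Rightarrow> real" where
  "cabs s = exp (Re s)"

definition carg :: "cover \<Rightarrow> real" where
  "carg s = Im s"

definition cpow :: "cover \<Rightarrow> complex \<Rightarrow> complex" where
  "cpow s c = exp (c * s)"

definition cpoint :: "real \<Rightarrow> real \<Rightarrow> cover" where
  "cpoint r \<phi> = Complex (ln r) \<phi>"

text \<open>Derivative with respect to the local coordinate \<open>x = exp s\<close> (chain rule).\<close>

definition ddx :: "(cover \<Rightarrow> complex) \<Rightarrow> cover \<Rightarrow> complex" where
  "ddx y s = deriv y s / cproj s"

definition PVI_rhs :: "complex \<Rightarrow> complex \<Rightarrow> complex \<Rightarrow> complex \<Rightarrow> complex" where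
  "PVI_rhs \<mu> x y y' =
     1/2 * (1/y + 1/(y - 1) + 1/(y - x)) * y'^2
     - (1/x + 1/(x - 1) + 1/(y - x)) * y'
     + 1/2 * (y * (y - 1) * (y - x) / (x^2 * (x - 1)^2))
         * ((2*\<mu> - 1)^2 + x * (x - 1) / (y - x)^2)"

text \<open>
  The right-hand side is undefined where \<open>y\<close> takes one of the values \<open>0, 1, x\<close>. Solutions do
  attain \<open>0\<close> and \<open>x\<close> (at double zeros of \<open>y\<close> and of \<open>y - x\<close>) without ceasing to be analytic, so
  the equation is imposed only at the other points. An analytic function which is identically
  \<open>0\<close>, \<open>1\<close> or \<open>x\<close> on a connected domain passes this test; these are also degenerate solutions of
  the equation with denominators cleared.
\<close>

definition solves_PVI :: "complex \<Rightarrow> (cover \<Rightarrow> complex) \<Rightarrow> cover set \<Rightarrow> bool" where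
  "solves_PVI \<mu> y D \<longleftrightarrow>
     y analytic_on D \<and>
     (\<forall>s\<in>D. cproj s \<noteq> 1 \<and> y s \<noteq> 0 \<and> y s \<noteq> 1 \<and> y s \<noteq> cproj s \<longrightarrow>
        ddx (ddx y) s = PVI_rhs \<mu> (cproj s) (y s) (ddx y s))"

definition dom_nonreal :: "real \<Rightarrow> complex \<Rightarrow> real \<Rightarrow> real \<Rightarrow> real \<Rightarrow> cover set" where
  "dom_nonreal \<epsilon> \<sigma> \<theta>\<^sub>1 \<theta>\<^sub>2 \<tau> =
     {s. cabs s < \<epsilon> \<and>
         exp (- \<theta>\<^sub>1 * Im \<sigma>) * cabs s powr \<tau> \<le> cmod (cpow s \<sigma>) \<and>
         cmod (cpow s \<sigma>) \<le> exp (- \<theta>\<^sub>2 * Im \<sigma>)}"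

definition dom_real :: "real \<Rightarrow> cover set" where
  "dom_real \<epsilon> = {s. cabs s < \<epsilon>}"

text \<open>The path from \<open>s0\<close> towards \<open>x = 0\<close>, parametrised by the modulus \<open>r = |x|\<close>.\<close>

definition spiral :: "complex \<Rightarrow> real \<Rightarrow> cover \<Rightarrow> real \<Rightarrow> cover" where
  "spiral \<sigma> \<Sigma> s0 r = cpoint r (carg s0 + (Re \<sigma> - \<Sigma>) / Im \<sigma> * ln (r / cabs s0))"

definition path_to_zero :: "(real \<Rightarrow> cover) \<Rightarrow> cover set \<Rightarrow> bool" where
  "path_to_zero \<gamma> D \<longleftrightarrow>
     continuous_on {0<..1} \<gamma> \<and> \<gamma> ` {0<..1} \<subseteq> D \<and> ((\<lambda>t. cabs (\<gamma> t)) \<longlongrightarrow> 0) (at_right 0)"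

text \<open>For \<open>\<Sigma> = 0\<close> the real phase of \<open>exp (\<sigma> * s)\<close> is \<open>Im (\<sigma> * s)\<close>.\<close>

definition amplitude :: "complex \<Rightarrow> complex \<Rightarrow> real \<Rightarrow> cover \<Rightarrow> cover \<Rightarrow> complex" where
  "amplitude \<sigma> a \<Sigma> s0 s =
     (if \<Sigma> = 0 then
        (let \<rho> = complex_of_real (cmod (cpow s0 \<sigma>)); \<alpha> = Im (\<sigma> * s) in
         a * (1 + 1 / (2 * a) * \<rho> * exp (\<i> * of_real \<alpha>)
                + 1 / (16 * a^2) * \<rho>^2 * exp (2 * \<i> * of_real \<alpha>)))
      else a)"

text \<open>\<open>y = A x^(1-\<sigma>) (1 + O(|x|^\<delta>))\<close> along \<open>\<gamma>\<close> as the parameter tends to \<open>0\<close> from the right.\<close>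

definition asymp_along ::
  "(cover \<Rightarrow> complex) \<Rightarrow> (cover \<Rightarrow> complex) \<Rightarrow> complex \<Rightarrow> real \<Rightarrow> (real \<Rightarrow> cover) \<Rightarrow> bool" where
  "asymp_along y A \<sigma> \<delta> \<gamma> \<longleftrightarrow>
     (\<exists>h. h \<in> O[at_right 0](\<lambda>t. complex_of_real (cabs (\<gamma> t) powr \<delta>)) \<and>
          (\<forall>\<^sub>F t in at_right 0. y (\<gamma> t) = A (\<gamma> t) * cpow (\<gamma> t) (1 - \<sigma>) * (1 + h t)))"

text \<open>\<open>y = x^(1-\<sigma>) (A + O(|x|^\<delta>))\<close>; the same as above if \<open>A\<close> is bounded and bounded away from 0.\<close>

definition asymp_along_add ::
  "(cover \<Rightarrow> complex) \<Rightarrow> (cover \<Rightarrow> complex) \<Rightarrow> complex \<Rightarrow> real \<Rightarrow> (real \<Rightarrow> cover) \<Rightarrow> bool" where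
  "asymp_along_add y A \<sigma> \<delta> \<gamma> \<longleftrightarrow>
     (\<exists>h. h \<in> O[at_right 0](\<lambda>t. complex_of_real (cabs (\<gamma> t) powr \<delta>)) \<and>
          (\<forall>\<^sub>F t in at_right 0. y (\<gamma> t) = cpow (\<gamma> t) (1 - \<sigma>) * (A (\<gamma> t) + h t)))"

text \<open>
  For \<open>\<Sigma> = 0\<close> the amplitude is \<open>a (1 + x^\<sigma>/(4a))^2\<close>, and \<open>|x^\<sigma>|\<close> is constant along the path. If
  this constant is \<open>4|a|\<close>, the amplitude vanishes at infinitely many points of the path, near which
  \<open>y\<close> has zeros in slightly different places; there the relative error \<open>1 + O(|x|^\<delta>)\<close> has to be
  read relative to \<open>x^(1-\<sigma>)\<close>. For \<open>\<Sigma> > 0\<close> the amplitude omits the relative term \<open>x^\<sigma>/(2a)\<close>,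
  which is of exact order \<open>|x|^\<Sigma>\<close>; so the exponent cannot exceed \<open>\<Sigma>\<close>.
\<close>

definition spiral_asymp ::
  "(cover \<Rightarrow> complex) \<Rightarrow> complex \<Rightarrow> complex \<Rightarrow> real \<Rightarrow> real \<Rightarrow> cover \<Rightarrow> bool" where
  "spiral_asymp y \<sigma> a \<delta> \<Sigma> s0 \<longleftrightarrow>
     (if \<Sigma> = 0 then
        (if cmod (cpow s0 \<sigma>) = 4 * cmod a
         then asymp_along_add y (amplitude \<sigma> a \<Sigma> s0) \<sigma> \<delta> (spiral \<sigma> \<Sigma> s0)
         else asymp_along y (amplitude \<sigma> a \<Sigma> s0) \<sigma> \<delta> (spiral \<sigma> \<Sigma> s0))
      else asymp_along y (amplitude \<sigma> a \<Sigma> s0) \<sigma> (min \<delta> \<Sigma>) (spiral \<sigma> \<Sigma> s0))"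

end

theory Submission
  imports Defs
begin

text \<open>
  Write \<open>x = exp s\<close> and \<open>y = x (1 + cosh \<omega>) / 2\<close>. With \<open>B = x sinh \<omega>\<close>, so that \<open>B\<^sup>2 = 4 y (y - x)\<close>,
  \<open>PVI\<close> becomes an equation \<open>\<omega>'' = f(x, y, B, \<omega>')\<close> (the prime is \<open>d/ds\<close>) whose right-hand side is
  regular at \<open>y = 0\<close> and \<open>y = x\<close> and of order \<open>O(|x| + |y| + |B|)\<close>. Hence \<open>\<omega> = \<sigma> s + c + w\<close> with a
  small correction \<open>w\<close>. On a convex region which is invariant under translation along a ray towards
  \<open>Re s = -\<infinity>\<close>, and on which \<open>x\<close>, \<open>x\<^bsup>1+\<sigma>\<^esup>\<close> and \<open>x\<^bsup>1-\<sigma>\<^esup>\<close> decay exponentially in \<open>Re s\<close>, Picard iteration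
  with the primitives that vanish at the end of the ray converges and gives \<open>w = O(|x|\<^bsup>q\<^esup>)\<close>.
  Finally \<open>y = x\<^bsup>1-\<sigma>\<^esup> (exp (-c) / 4) (exp (-w) (1 + exp w z)\<^sup>2)\<close> with \<open>z = exp c x\<^bsup>\<sigma>\<^esup>\<close>; the amplitude \<open>a\<close> is
  obtained for \<open>exp (-c) = 4 a\<close> if \<open>\<sigma> \<noteq> 0\<close>, and for \<open>cosh c = 2 a - 1\<close> if \<open>\<sigma> = 0\<close>.
\<close>

section \<open>Second-order equations on ray-invariant regions\<close>

text \<open>Restrict \<open>F\<close> to the complex line through the two points. Around each point
  of the segment there is a disc on which the line stays inside the region where \<open>B\<close>
  bounds \<open>F\<close>, so Cauchy's inequality bounds the derivative along the segment.
  Holomorphy is assumed only after composition with holomorphic curves, which avoids a notion of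
  holomorphy in several variables.\<close>

lemma Lipschitz_of_bounded_holomorphic_on_lines:
  fixes F :: "complex \<Rightarrow> complex \<Rightarrow> complex"
  assumes hol: "\<And>T g h. \<lbrakk>open T; g holomorphic_on T; h holomorphic_on T;
                  \<And>z. z \<in> T \<Longrightarrow> cmod (g z) < 2; \<And>z. z \<in> T \<Longrightarrow> cmod (h z) < 2\<rbrakk>
                  \<Longrightarrow> (\<lambda>z. F (g z) (h z)) holomorphic_on T"
    and bound: "\<And>w p. \<lbrakk>cmod w < 2; cmod p < 2\<rbrakk> \<Longrightarrow> cmod (F w p) \<le> B"
    and unit: "cmod w \<le> 1" "cmod p \<le> 1" "cmod w' \<le> 1" "cmod p' \<le> 1"
    and close: "cmod (w' - w) \<le> \<Delta>" "cmod (p' - p) \<le> \<Delta>"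
  shows "cmod (F w' p' - F w p) \<le> 2 * B * \<Delta>"
proof (cases "\<Delta> = 0")
  case True
  then show ?thesis using close by simp
next
  case False
  then have "\<Delta> > 0" using close(1) norm_ge_zero[of "w' - w"] by linarith
  define g where "g z = w + z * (w' - w)" for z
  define h where "h z = p + z * (p' - p)" for z
  \<comment> \<open>Moving \<open>z\<close> by \<open>r\<close> shifts either coordinate by at most
    1/2, from modulus at most 1 to modulus below 2. Cauchy's inequality then gives the factor
    1/\<open>r\<close> = 2 \<Delta>.\<close>
  define r where "r = 1 / (2 * \<Delta>)"
  have "r > 0" using \<open>\<Delta> > 0\<close> by (simp add: r_def)
  have seg: "cmod (w + z * (w' - w)) \<le> 1"
    if "z \<in> closed_segment 0 1" "cmod w \<le> 1" "cmod w' \<le> 1" for w w' z :: complex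
  proof -
    have "\<exists>u. 0 \<le> u \<and> u \<le> 1 \<and> z = of_real u"
      using that(1) by (simp add: in_segment scaleR_conv_of_real)
    then obtain u where u: "0 \<le> u" "u \<le> 1" "z = of_real u"
      by blast
    have "w + z * (w' - w) = of_real (1 - u) * w + of_real u * w'"
      by (simp add: u algebra_simps)
    also have "cmod \<dots> \<le> (1 - u) * cmod w + u * cmod w'"
      by (rule order_trans[OF norm_triangle_ineq]) (simp add: norm_mult u del: of_real_diff)
    also have "\<dots> \<le> (1 - u) * 1 + u * 1"
      using u that by (intro add_mono mult_left_mono) auto
    finally show ?thesis by simp
  qed
  have near: "cmod (w + x * (w' - w)) < 2"
    if "z \<in> closed_segment 0 1" "cmod w \<le> 1" "cmod w' \<le> 1" "cmod (w' - w) \<le> \<Delta>" "dist z x \<le> r"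
    for w w' z x :: complex
  proof -
    have "w + x * (w' - w) = (w + z * (w' - w)) + (x - z) * (w' - w)"
      by (simp add: algebra_simps)
    also have "cmod \<dots> \<le> 1 + cmod (x - z) * cmod (w' - w)"
      by (rule order_trans[OF norm_triangle_ineq]) (use seg[OF that(1-3)] in \<open>simp add: norm_mult\<close>)
    also have "\<dots> \<le> 1 + r * \<Delta>"
      using that \<open>r > 0\<close> by (intro add_mono mult_mono) (auto simp: dist_norm norm_minus_commute)
    also have "\<dots> < 2"
      using \<open>\<Delta> > 0\<close> by (simp add: r_def)
    finally show ?thesis .
  qed
  define T where "T = {z. cmod (g z) < 2} \<inter> {z. cmod (h z) < 2}"
  have "open T"
    unfolding T_def g_def h_def
    by (intro open_Int open_Collect_less continuous_intros)
  have holT: "(\<lambda>z. F (g z) (h z)) holomorphic_on T"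
    by (rule hol[OF \<open>open T\<close>]) (auto simp: T_def g_def h_def intro!: holomorphic_intros)
  have cball_T: "cball z r \<subseteq> T" if "z \<in> closed_segment 0 1" for z
    using near[OF that] unit close by (auto simp: T_def g_def h_def)
  have seg_T: "closed_segment 0 1 \<subseteq> T"
    using cball_T \<open>r > 0\<close> by (meson centre_in_cball in_mono less_imp_le subsetI)
  have deriv_le: "cmod (deriv (\<lambda>z. F (g z) (h z)) z) \<le> 2 * B * \<Delta>" if z: "z \<in> closed_segment 0 1" for z
  proof -
    have "cmod ((deriv ^^ 1) (\<lambda>z. F (g z) (h z)) z) \<le> fact 1 * B / r ^ 1"
    proof (rule Cauchy_inequality)
      show "(\<lambda>z. F (g z) (h z)) holomorphic_on ball z r"
        using holT cball_T[OF z] by (meson ball_subset_cball holomorphic_on_subset)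
      show "continuous_on (cball z r) (\<lambda>z. F (g z) (h z))"
        using holT cball_T[OF z] by (meson holomorphic_on_imp_continuous_on holomorphic_on_subset)
      show "cmod (F (g x) (h x)) \<le> B" if "cmod (z - x) = r" for x
      proof -
        have "x \<in> T" using that cball_T[OF z] by (auto simp: dist_norm)
        then show ?thesis by (intro bound) (auto simp: T_def)
      qed
    qed (fact \<open>r > 0\<close>)
    then show ?thesis by (simp add: r_def field_simps)
  qed
  have "cmod ((\<lambda>z. F (g z) (h z)) 1 - (\<lambda>z. F (g z) (h z)) 0) \<le> 2 * B * \<Delta> * cmod (1 - 0)"
  proof (rule field_differentiable_bound[OF convex_closed_segment[of 0 1] _ deriv_le])
    show "((\<lambda>z. F (g z) (h z)) has_field_derivative deriv (\<lambda>z. F (g z) (h z)) z)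
            (at z within closed_segment 0 1)" if "z \<in> closed_segment 0 1" for z
      using holT \<open>open T\<close> seg_T that
      by (meson has_field_derivative_at_within holomorphic_derivI in_mono)
  qed auto
  then show ?thesis by (simp add: g_def h_def)
qed

text \<open>The increments telescope, and the Weierstrass M-test applies to their sum.\<close>

lemma uniform_limit_geometric:
  fixes f :: "nat \<Rightarrow> 'a \<Rightarrow> complex"
  assumes "\<And>n s. s \<in> U \<Longrightarrow> cmod (f (Suc n) s - f n s) \<le> C * (1/2) ^ n"
  shows "\<exists>g. uniform_limit U f g sequentially"
proof -
  have "uniformly_convergent_on U (\<lambda>n s. \<Sum>i<n. f (Suc i) s - f i s)"
    by (rule Weierstrass_m_test'[where M = "\<lambda>n. C * (1/2) ^ n"])
       (use assms in \<open>auto intro!: summable_mult summable_geometric\<close>)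
  then obtain l where l: "uniform_limit U (\<lambda>n s. \<Sum>i<n. f (Suc i) s - f i s) l sequentially"
    by (auto simp: uniformly_convergent_on_def)
  have "uniform_limit U (\<lambda>n s. (\<Sum>i<n. f (Suc i) s - f i s) + f 0 s) (\<lambda>s. l s + f 0 s) sequentially"
    by (intro uniform_limit_intros l)
  moreover have "(\<lambda>n s. (\<Sum>i<n. f (Suc i) s - f i s) + f 0 s) = f"
  proof (intro ext)
    show "(\<Sum>i<n. f (Suc i) s - f i s) + f 0 s = f n s" for n s
      by (subst sum_lessThan_telescope) simp
  qed
  ultimately show ?thesis by auto
qed

text \<open>By Weierstrass the derivatives converge to the derivative of the limit, and uniqueness
  of limits identifies it with \<open>l\<close>. This passes a differential equation to the limit of
  an iteration.\<close>

lemma has_field_derivative_uniform_limit: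
  fixes f :: "nat \<Rightarrow> complex \<Rightarrow> complex"
  assumes "open U" "uniform_limit U f g sequentially" "s \<in> U"
    and df: "\<And>n s. s \<in> U \<Longrightarrow> (f n has_field_derivative f' n s) (at s)"
    and lim: "(\<lambda>n. f' n s) \<longlonglongrightarrow> l"
  shows "(g has_field_derivative l) (at s)"
proof -
  have "\<exists>d. 0 < d \<and> cball x d \<subseteq> U \<and> uniform_limit (cball x d) f g sequentially" if "x \<in> U" for x
    using assms(1,2) that by (meson open_contains_cball uniform_limit_on_subset)
  from has_complex_derivative_uniform_sequence[where f = f and f' = f', OF \<open>open U\<close> df this]
  obtain g' where g': "\<forall>x\<in>U. (g has_field_derivative g' x) (at x) \<and> (\<lambda>n. f' n x) \<longlonglongrightarrow> g' x"
    by blast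
  with \<open>s \<in> U\<close> lim have "g' s = l" using LIMSEQ_unique by blast
  then show ?thesis using g' \<open>s \<in> U\<close> by blast
qed

section \<open>Decaying primitives along rays\<close>

text \<open>Normalising \<open>Re d = 1\<close> makes a step of length \<open>t\<close> along the
  ray multiply |x| by exp(-t). The direction may be oblique, so that a ray can follow a spiral on
  which |x^\<sigma>| is constant.\<close>

locale ray_invariant =
  fixes U :: "complex set" and d :: complex and q :: real
  assumes open_U: "open U" and convex_U: "convex U"
    and ray: "\<And>s t. \<lbrakk>s \<in> U; 0 \<le> t\<rbrakk> \<Longrightarrow> s - of_real t * d \<in> U"
    and Re_d: "Re d = 1" and q_pos: "0 < q" and q_le: "q \<le> 1"
    and Re_U: "\<And>s. s \<in> U \<Longrightarrow> Re s \<le> 0"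
begin

text \<open>This is |x|^q in the coordinate x = exp s.\<close>

definition decay :: "complex \<Rightarrow> real" where
  "decay s = exp (q * Re s)"

text \<open>The integral of \<open>cmod d * exp (- q * t)\<close> over t \<ge> 0: the factor lost
  when a function of size \<open>decay\<close> is integrated along a ray.\<close>

definition K :: real where
  "K = cmod d / q"

lemma decay_pos [simp]: "0 < decay s" "0 \<le> decay s"
  by (simp_all add: decay_def)

lemma decay_le_1: "s \<in> U \<Longrightarrow> decay s \<le> 1"
  using Re_U q_pos by (simp add: decay_def mult_nonneg_nonpos)

lemma K_ge_1: "1 \<le> K"
proof -
  have "1 \<le> cmod d" using complex_Re_le_cmod[of d] Re_d by simp
  then show ?thesis using q_pos q_le by (simp add: K_def)
qed

lemma decay_ray: "decay (s - of_real t * d) = decay s * exp (- q * t)"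
  by (simp add: decay_def Re_d algebra_simps flip: exp_add)

lemma tendsto_exp_neg: "((\<lambda>t. exp (- q * t)) \<longlongrightarrow> 0) at_top"
proof -
  have "filterlim (\<lambda>t. q * t) at_top at_top"
    by (rule filterlim_tendsto_pos_mult_at_top[OF tendsto_const q_pos filterlim_ident])
  then have "filterlim (\<lambda>t. - (q * t)) at_bot at_top"
    by (simp add: filterlim_uminus_at_top)
  then show ?thesis
    using filterlim_compose[OF exp_at_bot] by simp
qed

text \<open>Mean value inequality along the ray: the real function \<phi> in the proof is a
  primitive of the bound for the derivative of \<open>g\<close> on the ray.\<close>

lemma ray_variation:
  assumes dg: "\<And>s. s \<in> U \<Longrightarrow> (g has_field_derivative f s) (at s)"
    and f: "\<And>s. s \<in> U \<Longrightarrow> cmod (f s) \<le> C * decay s"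
    and s: "s \<in> U" and t: "0 \<le> t" "t \<le> t'"
  shows "cmod (g (s - of_real t' * d) - g (s - of_real t * d)) \<le> K * C * decay s * (exp (- q * t) - exp (- q * t'))"
proof (cases "t = t'")
  case False
  define \<phi> where "\<phi> t = - K * C * decay s * exp (- q * t)" for t
  define G where "G t = g (s - of_real t * d)" for t
  have dG: "(G has_vector_derivative - d * f (s - of_real x * d)) (at x)" if "0 \<le> x" for x
    unfolding G_def
    by (rule has_vector_derivative_eq_rhs, rule field_vector_diff_chain_at[unfolded o_def])
       (auto intro!: derivative_eq_intros dg ray s that)
  have "cmod (G t' - G t) \<le> \<phi> t' - \<phi> t"
  proof (rule differentiable_bound_general)
    show "t < t'" using False t by simp
    show "continuous_on {t..t'} G"
      using has_vector_derivative_continuous[OF dG] t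
      by (intro continuous_at_imp_continuous_on ballI) auto
    show "continuous_on {t..t'} \<phi>" unfolding \<phi>_def by (intro continuous_intros)
    show "(G has_vector_derivative - d * f (s - of_real x * d)) (at x)" if "t < x" for x
      using that t by (intro dG) simp
    show "(\<phi> has_vector_derivative q * K * C * decay s * exp (- q * x)) (at x)" for x
      unfolding \<phi>_def has_real_derivative_iff_has_vector_derivative[symmetric]
      by (auto intro!: derivative_eq_intros)
    show "cmod (- d * f (s - of_real x * d)) \<le> q * K * C * decay s * exp (- q * x)" if "t < x" for x
    proof -
      have "cmod (f (s - of_real x * d)) \<le> C * (decay s * exp (- q * x))"
        using f[OF ray[OF s, of x]] that t by (simp add: decay_ray)
      then have "cmod d * cmod (f (s - of_real x * d)) \<le> cmod d * (C * (decay s * exp (- q * x)))"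
        by (rule mult_left_mono) simp
      then show ?thesis using q_pos by (simp add: norm_mult K_def field_simps)
    qed
  qed
  then show ?thesis by (simp add: \<phi>_def G_def algebra_simps)
qed simp

text \<open>Compare \<open>g\<close> at \<open>s\<close> with its value far out on the ray and let t
  tend to infinity: the far value vanishes, so an arbitrary decay constant \<open>C'\<close>
  improves to \<open>K * C\<close>.\<close>

lemma decaying_primitive_bound:
  assumes dg: "\<And>s. s \<in> U \<Longrightarrow> (g has_field_derivative f s) (at s)"
    and f: "\<And>s. s \<in> U \<Longrightarrow> cmod (f s) \<le> C * decay s"
    and g: "\<And>s. s \<in> U \<Longrightarrow> cmod (g s) \<le> C' * decay s"
    and s: "s \<in> U"
  shows "cmod (g s) \<le> K * C * decay s"
proof -
  have "cmod (g s) \<le> C' * decay s * exp (- q * t) + K * C * decay s * (1 - exp (- q * t))" if "t \<ge> 0" for t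
  proof -
    have "cmod (g s) \<le> cmod (g (s - of_real t * d)) + cmod (g (s - of_real t * d) - g s)"
      using norm_triangle_ineq4[of "g (s - of_real t * d)" "g (s - of_real t * d) - g s"] by simp
    moreover have "cmod (g (s - of_real t * d) - g s) \<le> K * C * decay s * (1 - exp (- q * t))"
      using ray_variation[OF dg f s order_refl that] by simp
    moreover have "cmod (g (s - of_real t * d)) \<le> C' * decay s * exp (- q * t)"
      using g[OF ray[OF s that]] by (simp add: decay_ray)
    ultimately show ?thesis by linarith
  qed
  then have ev: "\<forall>\<^sub>F t in at_top. cmod (g s)
      \<le> C' * decay s * exp (- q * t) + K * C * decay s * (1 - exp (- q * t))"
    by (rule eventually_mono[OF eventually_ge_at_top[of 0]])
  have "((\<lambda>t. C' * decay s * exp (- q * t) + K * C * decay s * (1 - exp (- q * t)))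
          \<longlongrightarrow> C' * decay s * 0 + K * C * decay s * (1 - 0)) at_top"
    by (intro tendsto_intros tendsto_exp_neg)
  from tendsto_lowerbound[OF this ev] show ?thesis by simp
qed

text \<open>Any primitive \<open>G\<close> on the convex region has a limit along each ray. The
  limit is the same for all rays, since the segment joining corresponding points of two rays keeps
  its length while \<open>f\<close> decays on it. Subtracting this limit makes the primitive vanish
  at the end of every ray.\<close>

lemma decaying_primitive_exists:
  assumes hol: "f holomorphic_on U" and f: "\<And>s. s \<in> U \<Longrightarrow> cmod (f s) \<le> C * decay s"
  shows "\<exists>g. \<forall>s\<in>U. (g has_field_derivative f s) (at s) \<and> cmod (g s) \<le> K * C * decay s"
proof (cases "U = {}")
  case False
  then obtain s0 where s0: "s0 \<in> U" by blast
  have C: "0 \<le> C"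
    using f[OF s0] norm_ge_zero[of "f s0"] decay_pos(1)[of s0] by (smt (verit) mult_neg_pos)
  obtain G where G: "\<And>s. s \<in> U \<Longrightarrow> (G has_field_derivative f s) (at s)"
    using holomorphic_convex_primitive'[OF convex_U open_U hol] open_U
    by (metis at_within_open)
  define \<gamma> where "\<gamma> s n = G (s - of_real (real n) * d)" for s n
  have Cauchy: "Cauchy (\<gamma> s)" if s: "s \<in> U" for s
  proof (rule metric_CauchyI)
    fix e :: real assume "e > 0"
    have "((\<lambda>n. K * C * decay s * exp (- q * real n)) \<longlongrightarrow> K * C * decay s * 0) sequentially"
      by (intro tendsto_intros filterlim_compose[OF tendsto_exp_neg filterlim_real_sequentially])
    then have "\<forall>\<^sub>F n in sequentially. K * C * decay s * exp (- q * real n) < e"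
      using \<open>e > 0\<close> by (intro order_tendstoD(2)[where y = "K * C * decay s * 0"]) auto
    then obtain N where N: "K * C * decay s * exp (- q * real N) < e"
      by (meson eventually_sequentially order_refl)
    have *: "dist (\<gamma> s m) (\<gamma> s n) < e" if "N \<le> n" "n \<le> m" for m n
    proof -
      have "dist (\<gamma> s m) (\<gamma> s n) \<le> K * C * decay s * (exp (- q * real n) - exp (- q * real m))"
        unfolding \<gamma>_def dist_norm using that by (intro ray_variation[OF G f s]) auto
      also have "\<dots> \<le> K * C * decay s * exp (- q * real N)"
      proof (rule mult_left_mono)
        have "exp (- q * real n) \<le> exp (- q * real N)"
          using that q_pos by simp
        then show "exp (- q * real n) - exp (- q * real m) \<le> exp (- q * real N)"
          using exp_gt_zero[of "- q * real m"] by linarith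
      qed (use C K_ge_1 in simp)
      finally show ?thesis using N by linarith
    qed
    show "\<exists>M. \<forall>m\<ge>M. \<forall>n\<ge>M. dist (\<gamma> s m) (\<gamma> s n) < e"
      using * by (metis dist_commute nle_le)
  qed
  define l where "l = lim (\<gamma> s0)"
  have lim0: "\<gamma> s0 \<longlonglongrightarrow> l"
    using Cauchy[OF s0] by (simp add: l_def Cauchy_convergent_iff convergent_LIMSEQ_iff)
  have lim: "\<gamma> s \<longlonglongrightarrow> l" if s: "s \<in> U" for s
  proof -
    define M where "M = max (decay s) (decay s0)"
    have diff: "cmod (\<gamma> s n - \<gamma> s0 n) \<le> C * M * cmod (s - s0) * exp (- q * real n)" for n
    proof -
      define V where "V = closed_segment (s - of_real (real n) * d) (s0 - of_real (real n) * d)"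
      have VU: "V \<subseteq> U"
        unfolding V_def using ray[OF s, of "real n"] ray[OF s0, of "real n"] convex_U
        by (intro closed_segment_subset) auto
      have le: "cmod (f z) \<le> C * (M * exp (- q * real n))" if z: "z \<in> V" for z
      proof -
        \<comment> \<open>A left half-plane is convex, so on the segment Re, and with it
          \<open>decay\<close>, does not exceed the larger of its two endpoint values.\<close>
        have "V \<subseteq> {z. Re z \<le> max (Re (s - of_real (real n) * d)) (Re (s0 - of_real (real n) * d))}"
          unfolding V_def by (intro closed_segment_subset convex_halfspace_Re_le) auto
        with z have "Re z \<le> max (Re (s - of_real (real n) * d)) (Re (s0 - of_real (real n) * d))"
          by blast
        then have "q * Re z \<le> max (q * Re (s - of_real (real n) * d)) (q * Re (s0 - of_real (real n) * d))"
          using q_pos by (auto simp: max_def split: if_splits)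
        then have "decay z \<le> max (decay (s - of_real (real n) * d)) (decay (s0 - of_real (real n) * d))"
          unfolding decay_def by (auto simp: max_def)
        also have "\<dots> = M * exp (- q * real n)"
          unfolding decay_ray M_def by (simp add: max_def mult_right_mono)
        finally show ?thesis
          using f[of z] z VU C by (meson in_mono mult_left_mono order_trans)
      qed
      have "cmod (\<gamma> s n - \<gamma> s0 n) \<le> C * (M * exp (- q * real n)) *
          cmod ((s - of_real (real n) * d) - (s0 - of_real (real n) * d))"
        unfolding \<gamma>_def
        by (rule field_differentiable_bound[of V, OF _ _ le])
           (use VU G in \<open>auto simp: V_def intro: has_field_derivative_at_within\<close>)
      then show ?thesis by (simp add: mult_ac)
    qed
    have "(\<lambda>n. \<gamma> s n - \<gamma> s0 n) \<longlonglongrightarrow> 0"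
    proof (rule Lim_null_comparison)
      show "\<forall>\<^sub>F n in sequentially. cmod (\<gamma> s n - \<gamma> s0 n) \<le> C * M * cmod (s - s0) * exp (- q * real n)"
        using diff by simp
      show "(\<lambda>n. C * M * cmod (s - s0) * exp (- q * real n)) \<longlonglongrightarrow> 0"
        by (intro tendsto_mult_right_zero filterlim_compose[OF tendsto_exp_neg filterlim_real_sequentially])
    qed
    from tendsto_add[OF this lim0] show ?thesis by simp
  qed
  have "((\<lambda>z. G z - l) has_field_derivative f s) (at s) \<and> cmod (G s - l) \<le> K * C * decay s"
    if s: "s \<in> U" for s
  proof
    show "((\<lambda>z. G z - l) has_field_derivative f s) (at s)"
      using G[OF s] by (auto intro!: derivative_eq_intros)
    have "cmod (\<gamma> s n - G s) \<le> K * C * decay s" for n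
    proof -
      have "cmod (\<gamma> s n - G s) \<le> K * C * decay s * (1 - exp (- q * real n))"
        unfolding \<gamma>_def using ray_variation[OF G f s order_refl, of "real n"] by simp
      also have "\<dots> \<le> K * C * decay s * 1"
        using C K_ge_1 by (intro mult_left_mono) auto
      finally show ?thesis by simp
    qed
    then have "cmod (l - G s) \<le> K * C * decay s"
      by (intro Lim_norm_ubound[OF _ tendsto_diff[OF lim[OF s] tendsto_const]]) auto
    then show "cmod (G s - l) \<le> K * C * decay s" by (simp add: norm_minus_commute)
  qed
  then show ?thesis by blast
qed auto

text \<open>The decay constant is quantified inside the choice, so that \<open>prim\<close> depends
  on \<open>f\<close> alone; \<open>decaying_primitive_bound\<close> recovers the good constant
  afterwards.\<close>

definition prim :: "(complex \<Rightarrow> complex) \<Rightarrow> complex \<Rightarrow> complex" where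
  "prim f = (SOME g. \<exists>C. \<forall>s\<in>U. (g has_field_derivative f s) (at s) \<and> cmod (g s) \<le> C * decay s)"

lemma
  assumes "f holomorphic_on U" "\<And>s. s \<in> U \<Longrightarrow> cmod (f s) \<le> C * decay s" "s \<in> U"
  shows has_field_derivative_prim: "(prim f has_field_derivative f s) (at s)"
    and norm_prim_le: "cmod (prim f s) \<le> K * C * decay s"
proof -
  have ex: "\<exists>g C. \<forall>s\<in>U. (g has_field_derivative f s) (at s) \<and> cmod (g s) \<le> C * decay s"
    using decaying_primitive_exists[OF assms(1,2)] by blast
  from someI_ex[OF ex] obtain C' where C': "\<And>s. s \<in> U \<Longrightarrow> (prim f has_field_derivative f s) (at s)"
      "\<And>s. s \<in> U \<Longrightarrow> cmod (prim f s) \<le> C' * decay s"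
    unfolding prim_def[symmetric] by blast
  show "(prim f has_field_derivative f s) (at s)" using C' assms(3) by blast
  show "cmod (prim f s) \<le> K * C * decay s"
    by (rule decaying_primitive_bound[OF C'(1) assms(2) C'(2) assms(3)])
qed

lemma holomorphic_prim:
  assumes "f holomorphic_on U" "\<And>s. s \<in> U \<Longrightarrow> cmod (f s) \<le> C * decay s"
  shows "prim f holomorphic_on U"
  using has_field_derivative_prim[OF assms] open_U by (metis holomorphic_on_open)

text \<open>The difference of the two primitives is itself a decaying primitive of
  \<open>f - h\<close>, so its crude constant \<open>2 * K * C\<close> improves to
  \<open>K * \<Delta>\<close>.\<close>

lemma norm_prim_diff_le:
  assumes f: "f holomorphic_on U" "\<And>s. s \<in> U \<Longrightarrow> cmod (f s) \<le> C * decay s"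
    and h: "h holomorphic_on U" "\<And>s. s \<in> U \<Longrightarrow> cmod (h s) \<le> C * decay s"
    and diff: "\<And>s. s \<in> U \<Longrightarrow> cmod (f s - h s) \<le> \<Delta> * decay s" and s: "s \<in> U"
  shows "cmod (prim f s - prim h s) \<le> K * \<Delta> * decay s"
proof (rule decaying_primitive_bound[where f = "\<lambda>s. f s - h s" and C' = "2 * K * C", OF _ diff _ s])
  fix z assume z: "z \<in> U"
  show "((\<lambda>s. prim f s - prim h s) has_field_derivative f z - h z) (at z)"
    by (intro derivative_intros has_field_derivative_prim[OF f z] has_field_derivative_prim[OF h z])
  show "cmod (prim f z - prim h z) \<le> 2 * K * C * decay z"
    using norm_triangle_ineq4[of "prim f z" "prim h z"] norm_prim_le[OF f z] norm_prim_le[OF h z]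
    by simp
qed

section \<open>Picard iteration for the second-order equation\<close>

text \<open>The unknown is the derivative p of w, with w recovered as \<open>prim p\<close>, and the
  iteration is p -> \<open>prim (step p)\<close>. The bound on \<open>F\<close> is at the same time
  a Lipschitz bound, by Cauchy's inequality; smallness of \<open>m\<close> gives both invariance and
  contraction by 1/2.\<close>

lemma second_order_solution:
  fixes F :: "complex \<Rightarrow> complex \<Rightarrow> complex \<Rightarrow> complex"
  assumes hol: "\<And>T f g h. \<lbrakk>open T; f holomorphic_on T; g holomorphic_on T; h holomorphic_on T;
                  f ` T \<subseteq> U; \<And>z. z \<in> T \<Longrightarrow> cmod (g z) < 2; \<And>z. z \<in> T \<Longrightarrow> cmod (h z) < 2\<rbrakk>
                  \<Longrightarrow> (\<lambda>z. F (f z) (g z) (h z)) holomorphic_on T"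
    and bound: "\<And>s w p. \<lbrakk>s \<in> U; cmod w < 2; cmod p < 2\<rbrakk> \<Longrightarrow> cmod (F s w p) \<le> m * decay s"
    and small: "4 * K\<^sup>2 * m \<le> 1" and m: "0 \<le> m"
  shows "\<exists>w p. \<forall>s\<in>U. (w has_field_derivative p s) (at s) \<and> (p has_field_derivative F s (w s) (p s)) (at s) \<and>
           cmod (w s) \<le> decay s \<and> cmod (p s) \<le> 1"
proof -
  have Kpos: "K > 0" using K_ge_1 by simp
  define step where "step p = (\<lambda>s. F s (prim p s) (p s))" for p
  define P where "P = rec_nat (\<lambda>_. 0) (\<lambda>_ p. prim (step p))"
  have P_0: "P 0 = (\<lambda>_. 0)" and P_Suc: "P (Suc n) = prim (step (P n))" for n
    by (simp_all add: P_def)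
  \<comment> \<open>The factor 1/\<open>K\<close> compensates the loss in one integration: then
    \<open>prim p\<close> is bounded by \<open>decay\<close>, and both arguments of \<open>F\<close>
    stay in the unit disc, where the Lipschitz estimate holds.\<close>
  define admissible where
    "admissible p \<longleftrightarrow> p holomorphic_on U \<and> (\<forall>s\<in>U. cmod (p s) \<le> 1 / K * decay s)" for p
  have adm: "p holomorphic_on U" "\<And>s. s \<in> U \<Longrightarrow> cmod (p s) \<le> 1 / K * decay s"
    "prim p holomorphic_on U" "\<And>s. s \<in> U \<Longrightarrow> cmod (prim p s) \<le> decay s"
    "\<And>s. s \<in> U \<Longrightarrow> cmod (p s) \<le> 1" "\<And>s. s \<in> U \<Longrightarrow> cmod (prim p s) \<le> 1"
    "step p holomorphic_on U" "\<And>s. s \<in> U \<Longrightarrow> cmod (step p s) \<le> m * decay s"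
    if "admissible p" for p
  proof -
    show 1: "p holomorphic_on U" and 2: "\<And>s. s \<in> U \<Longrightarrow> cmod (p s) \<le> 1 / K * decay s"
      using that by (auto simp: admissible_def)
    show 3: "prim p holomorphic_on U" by (rule holomorphic_prim[OF 1 2])
    show 4: "cmod (prim p s) \<le> decay s" if "s \<in> U" for s
      using norm_prim_le[OF 1 2 that] Kpos by simp
    show 5: "cmod (p s) \<le> 1" if "s \<in> U" for s
    proof -
      have "1 / K * decay s \<le> 1 * 1"
        using K_ge_1 decay_le_1[OF that] by (intro mult_mono) auto
      then show ?thesis using 2[OF that] by simp
    qed
    show 6: "cmod (prim p s) \<le> 1" if "s \<in> U" for s
      using 4[OF that] decay_le_1[OF that] by simp
    show "step p holomorphic_on U"
      unfolding step_def
      by (rule hol[OF open_U _ 3 1])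
         (auto intro!: holomorphic_intros le_less_trans[OF 5] le_less_trans[OF 6])
    show "cmod (step p s) \<le> m * decay s" if "s \<in> U" for s
      unfolding step_def using 5[OF that] 6[OF that] that by (intro bound) auto
  qed
  have m_small: "K * m \<le> 1 / K"
  proof -
    have "K * m * K \<le> 1" using small m Kpos by (simp add: power2_eq_square algebra_simps)
    then show ?thesis using Kpos by (simp add: field_simps)
  qed
  have adm_P: "admissible (P n)" for n
  proof (induction n)
    case 0
    then show ?case using Kpos by (auto simp: P_0 admissible_def)
  next
    case (Suc n)
    show ?case unfolding admissible_def P_Suc
    proof safe
      show "prim (step (P n)) holomorphic_on U"
        by (rule holomorphic_prim[OF adm(7,8)[OF Suc]])
      show "cmod (prim (step (P n)) s) \<le> 1 / K * decay s" if "s \<in> U" for s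
        using norm_prim_le[OF adm(7,8)[OF Suc] that] m_small
        by (meson decay_pos(2) mult_right_mono order_trans)
    qed
  qed
  have lip: "cmod (F s w' p' - F s w p) \<le> 2 * (m * decay s) * \<Delta>"
    if "s \<in> U" "cmod w \<le> 1" "cmod p \<le> 1" "cmod w' \<le> 1" "cmod p' \<le> 1"
       "cmod (w' - w) \<le> \<Delta>" "cmod (p' - p) \<le> \<Delta>" for s w p w' p' \<Delta>
  proof (rule Lipschitz_of_bounded_holomorphic_on_lines[OF _ _ that(2-7)])
    show "(\<lambda>z. F s (g z) (h z)) holomorphic_on T"
      if "open T" "g holomorphic_on T" "h holomorphic_on T"
         "\<And>z. z \<in> T \<Longrightarrow> cmod (g z) < 2" "\<And>z. z \<in> T \<Longrightarrow> cmod (h z) < 2" for T g h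
      by (rule hol[OF that(1) holomorphic_on_const that(2,3) _ that(4,5)]) (use \<open>s \<in> U\<close> in auto)
  qed (rule bound[OF \<open>s \<in> U\<close>])
  have prim_diff: "cmod (prim (P (Suc n)) s - prim (P n) s) \<le> K * \<Delta> * decay s"
    if "\<And>s. s \<in> U \<Longrightarrow> cmod (P (Suc n) s - P n s) \<le> \<Delta> * decay s" "s \<in> U" for n \<Delta> s
    by (rule norm_prim_diff_le[OF adm(1,2)[OF adm_P] adm(1,2)[OF adm_P] that])
  have diff: "cmod (P (Suc n) s - P n s) \<le> (1/2) ^ n * decay s" if "s \<in> U" for n s
    using that
  proof (induction n arbitrary: s)
    case 0
    have "1 / K * decay s \<le> 1 * decay s" using K_ge_1 by (intro mult_right_mono) auto
    then show ?case using adm(2)[OF adm_P[of 1] 0] by (simp add: P_0)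
  next
    case (Suc n)
    have "cmod (step (P (Suc n)) z - step (P n) z) \<le> 2 * m * K * (1/2) ^ n * decay z" if z: "z \<in> U" for z
    proof -
      \<comment> \<open>Since \<open>K\<close> is at least 1, \<open>K * (1/2) ^ n\<close> bounds
        the change of both arguments, the iterate and its primitive.\<close>
      have "cmod (step (P (Suc n)) z - step (P n) z) \<le> 2 * (m * decay z) * (K * (1/2) ^ n * 1)"
        unfolding step_def
      proof (rule lip[OF z])
        have "K * (1/2) ^ n * decay z \<le> K * (1/2) ^ n * 1"
          using decay_le_1[OF z] Kpos by (intro mult_left_mono) auto
        then show "cmod (prim (P (Suc n)) z - prim (P n) z) \<le> K * (1/2) ^ n * 1"
          using prim_diff[OF Suc.IH z] by linarith
        have "(1/2) ^ n * decay z \<le> K * (1/2) ^ n * 1"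
          using decay_le_1[OF z] K_ge_1 by (intro mult_mono) auto
        then show "cmod (P (Suc n) z - P n z) \<le> K * (1/2) ^ n * 1"
          using Suc.IH[OF z] by linarith
      qed (use z adm(5,6)[OF adm_P] in auto)
      then show ?thesis by (simp add: mult_ac)
    qed
    \<comment> \<open>Integrating once more costs a second factor \<open>K\<close>; the total 2 K^2
      m is half of the quantity assumed to be at most 1.\<close>
    from norm_prim_diff_le[OF adm(7,8)[OF adm_P] adm(7,8)[OF adm_P] this Suc.prems]
    have "cmod (P (Suc (Suc n)) s - P (Suc n) s) \<le> (4 * K\<^sup>2 * m) * ((1/2) ^ Suc n * decay s)"
      by (simp add: P_Suc power2_eq_square mult_ac)
    also have "\<dots> \<le> 1 * ((1/2) ^ Suc n * decay s)"
      using small by (intro mult_right_mono) auto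
    finally show ?case by simp
  qed
  have diff1: "cmod (P (Suc n) s - P n s) \<le> 1 * (1/2) ^ n" if "s \<in> U" for n s
  proof -
    have "(1/2) ^ n * decay s \<le> (1/2) ^ n * 1"
      using decay_le_1[OF that] by (intro mult_left_mono) auto
    then show ?thesis using diff[OF that, of n] by linarith
  qed
  have diff2: "cmod (prim (P (Suc n)) s - prim (P n) s) \<le> K * (1/2) ^ n" if "s \<in> U" for n s
  proof -
    have "K * (1/2) ^ n * decay s \<le> K * (1/2) ^ n * 1"
      using decay_le_1[OF that] Kpos by (intro mult_left_mono) auto
    then show ?thesis using prim_diff[OF diff that, of n] by simp
  qed
  obtain p where p: "uniform_limit U P p sequentially"
    using uniform_limit_geometric[of U P, OF diff1] by blast
  obtain w where w: "uniform_limit U (\<lambda>n. prim (P n)) w sequentially"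
    using uniform_limit_geometric[of U "\<lambda>n. prim (P n)", OF diff2] by blast
  have lim_p: "(\<lambda>n. P n s) \<longlonglongrightarrow> p s" and lim_w: "(\<lambda>n. prim (P n) s) \<longlonglongrightarrow> w s" if "s \<in> U" for s
    using tendsto_uniform_limitI[OF p that] tendsto_uniform_limitI[OF w that] by auto
  have w_le: "cmod (w s) \<le> decay s" and p_le: "cmod (p s) \<le> 1" if "s \<in> U" for s
    by (rule Lim_norm_ubound[OF _ lim_w[OF that]], simp_all add: adm(4)[OF adm_P] that)
       (rule Lim_norm_ubound[OF _ lim_p[OF that]], simp_all add: adm(5)[OF adm_P] that)
  have "(w has_field_derivative p s) (at s)" if "s \<in> U" for s
    by (rule has_field_derivative_uniform_limit[where f' = P, OF open_U w that _ lim_p[OF that]])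
       (rule has_field_derivative_prim[OF adm(1,2)[OF adm_P]])
  moreover have "(p has_field_derivative F s (w s) (p s)) (at s)" if s: "s \<in> U" for s
  proof (rule has_field_derivative_uniform_limit[where f = "\<lambda>n. P (Suc n)" and f' = "\<lambda>n. step (P n)", OF open_U _ s])
    show "uniform_limit U (\<lambda>n. P (Suc n)) p sequentially"
      using p by (simp add: uniform_limit_iff eventually_sequentially) (meson le_SucI)
    show "(P (Suc n) has_field_derivative step (P n) z) (at z)" if "z \<in> U" for n z
      unfolding P_Suc by (rule has_field_derivative_prim[OF adm(7,8)[OF adm_P] that])
    \<comment> \<open>Continuity of \<open>F\<close> in its last two arguments comes from the
      Lipschitz estimate, with the sum of the two distances as \<Delta>.\<close>
    have "(\<lambda>n. step (P n) s - F s (w s) (p s)) \<longlonglongrightarrow> 0"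
    proof (rule Lim_null_comparison)
      show "\<forall>\<^sub>F n in sequentially. cmod (step (P n) s - F s (w s) (p s))
          \<le> 2 * (m * decay s) * (cmod (prim (P n) s - w s) + cmod (P n s - p s))"
        unfolding step_def using w_le[OF s] decay_le_1[OF s] p_le[OF s] adm(5,6)[OF adm_P s]
        by (intro always_eventually allI lip[OF s]) auto
      show "(\<lambda>n. 2 * (m * decay s) * (cmod (prim (P n) s - w s) + cmod (P n s - p s))) \<longlonglongrightarrow> 0"
        by (rule tendsto_eq_intros lim_w[OF s] lim_p[OF s] refl)+ simp
    qed
    then show "(\<lambda>n. step (P n) s) \<longlonglongrightarrow> F s (w s) (p s)"
      by (simp add: LIM_zero_iff)
  qed
  ultimately show ?thesis using w_le p_le by blast
qed

end

section \<open>The trigonometric substitution\<close>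

text \<open>Here \<open>r\<close> and \<open>w2\<close> stand for the first and second s-derivatives
  of \<omega>. Then dy/dx is \<open>(y + B * r / 2) / x\<close>, and the right-hand side of the
  conclusion is the second x-derivative of y computed by the chain rule. The poles of PVI at y = 0
  and y = x cancel because of the relation for \<open>B\<^sup>2\<close>.\<close>

lemma PVI_rhs_trigonometric:
  fixes x y B r w2 \<mu> :: complex
  assumes ne: "x \<noteq> 0" "x \<noteq> 1" "y \<noteq> 0" "y \<noteq> 1" "y \<noteq> x"
    and B: "B\<^sup>2 = 4 * y * (y - x)"
    and w2: "w2 = (y * r + B * r\<^sup>2 / 4) / (y - 1) - x * r / (x - 1) - B / (4 * (y - 1) * (x - 1))
                  + (2 * \<mu> - 1)\<^sup>2 / 4 * B * (y - 1) / (x - 1)\<^sup>2"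
  shows "PVI_rhs \<mu> x y ((y + B * r / 2) / x) = (B * r + (2 * y - x) * r\<^sup>2 + B * w2) / (2 * x\<^sup>2)"
proof -
  define \<kappa> where "\<kappa> = (2 * \<mu> - 1)\<^sup>2"
  define b where "b = B * r"
  define R where "R = r\<^sup>2"
  have ne': "x - 1 \<noteq> 0" "y - 1 \<noteq> 0" "y - x \<noteq> 0" using ne by auto
  \<comment> \<open>After multiplication by \<open>B\<close>, this quantity occurs only in
    \<open>B * r\<close> and in its square, which the relation eliminates.\<close>
  have "B * w2 = (y * (B * r) + B\<^sup>2 * r\<^sup>2 / 4) / (y - 1) - x * (B * r) / (x - 1) - B\<^sup>2 / (4 * ((y - 1) * (x - 1)))
                  + \<kappa> / 4 * B\<^sup>2 * (y - 1) / (x - 1)\<^sup>2"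
    by (simp add: w2 \<kappa>_def power2_eq_square algebra_simps)
  also have "B\<^sup>2 = 4 * (y * (y - x))" by (simp add: B)
  also have "(y * (B * r) + 4 * (y * (y - x)) * r\<^sup>2 / 4) / (y - 1) - x * (B * r) / (x - 1)
      - 4 * (y * (y - x)) / (4 * ((y - 1) * (x - 1))) + \<kappa> / 4 * (4 * (y * (y - x))) * (y - 1) / (x - 1)\<^sup>2
      = (y * b + y * (y - x) * R) / (y - 1) - x * b / (x - 1) - y * (y - x) / ((y - 1) * (x - 1))
                  + \<kappa> * y * (y - x) * (y - 1) / (x - 1)\<^sup>2"
    unfolding b_def R_def mult_divide_mult_cancel_left_if by (simp add: mult.assoc)
  finally have Bw2: "B * w2 = \<dots>" .
  have sq: "(y + B * r / 2)\<^sup>2 = y\<^sup>2 + y * b + y * (y - x) * R"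
  proof -
    have "(y + B * r / 2)\<^sup>2 = y\<^sup>2 + y * b + B\<^sup>2 * R / 4"
      by (simp add: b_def R_def power2_eq_square algebra_simps)
    then show ?thesis unfolding B by simp
  qed
  have "PVI_rhs \<mu> x y ((y + B * r / 2) / x) =
     1/2 * (1/y + 1/(y - 1) + 1/(y - x)) * ((y\<^sup>2 + y * b + y * (y - x) * R) / x\<^sup>2)
     - (1/x + 1/(x - 1) + 1/(y - x)) * ((y + b / 2) / x)
     + 1/2 * (y * (y - 1) * (y - x) / (x^2 * (x - 1)^2)) * (\<kappa> + x * (x - 1) / (y - x)^2)"
    unfolding PVI_rhs_def \<kappa>_def power_divide sq b_def by simp
  also have "\<dots> = (b + (2 * y - x) * R + ((y * b + y * (y - x) * R) / (y - 1) - x * b / (x - 1)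
      - y * (y - x) / ((y - 1) * (x - 1)) + \<kappa> * y * (y - x) * (y - 1) / (x - 1)\<^sup>2)) / (2 * x\<^sup>2)"
  proof -
    \<comment> \<open>The identity is split into the parts with \<open>b\<close>, \<open>R\<close>,
      \<open>\<kappa>\<close> and none of them. Each part is a rational identity in x and y, checked
      separately after clearing denominators.\<close>
    define p q u where "p = y - 1" and "q = x - 1" and "u = y - x"
    have nz: "p \<noteq> 0" "q \<noteq> 0" "u \<noteq> 0" using ne' by (simp_all add: p_def q_def u_def)
    have xy: "y = p + 1" "x = q + 1" "u = p - q" by (simp_all add: p_def q_def u_def)
    have k: "1/2 * (y * p * u / (x^2 * q^2)) * \<kappa> = \<kappa> * y * u * p / q\<^sup>2 / (2 * x\<^sup>2)"
      using ne nz by (simp add: field_simps)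
    have bb: "1/2 * (1/y + 1/p + 1/u) * (y * b / x\<^sup>2) - (1/x + 1/q + 1/u) * (b / 2 / x)
        = (b + y * b / p - x * b / q) / (2 * x\<^sup>2)"
      using ne(1,3) nz by (simp add: divide_simps) (use xy in algebra)
    have RR: "1/2 * (1/y + 1/p + 1/u) * (y * u * R / x\<^sup>2)
        = ((2 * y - x) * R + y * u * R / p) / (2 * x\<^sup>2)"
      using ne(1,3) nz by (simp add: divide_simps) (use xy in algebra)
    have cc: "1/2 * (1/y + 1/p + 1/u) * (y\<^sup>2 / x\<^sup>2) - (1/x + 1/q + 1/u) * (y / x)
        + 1/2 * (y * p * u / (x^2 * q^2)) * (x * q / u^2) = - (y * u / (p * q)) / (2 * x\<^sup>2)"
      using ne(1,3) nz by (simp add: divide_simps) (use xy in algebra)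
    have "1/2 * (1/y + 1/p + 1/u) * ((y\<^sup>2 + y * b + y * u * R) / x\<^sup>2)
     - (1/x + 1/q + 1/u) * ((y + b / 2) / x)
     + 1/2 * (y * p * u / (x^2 * q^2)) * (\<kappa> + x * q / u^2)
     = (1/2 * (1/y + 1/p + 1/u) * (y\<^sup>2 / x\<^sup>2) - (1/x + 1/q + 1/u) * (y / x)
        + 1/2 * (y * p * u / (x^2 * q^2)) * (x * q / u^2))
     + 1/2 * (1/y + 1/p + 1/u) * (y * u * R / x\<^sup>2)
     + (1/2 * (1/y + 1/p + 1/u) * (y * b / x\<^sup>2) - (1/x + 1/q + 1/u) * (b / 2 / x))
     + 1/2 * (y * p * u / (x^2 * q^2)) * \<kappa>"
      by (simp only: add_divide_distrib distrib_left) simp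
    also have "\<dots> = (b + (2 * y - x) * R + ((y * b + y * u * R) / p - x * b / q
      - y * u / (p * q) + \<kappa> * y * u * p / q\<^sup>2)) / (2 * x\<^sup>2)"
      unfolding cc RR bb k by (simp add: add_divide_distrib diff_divide_distrib)
    finally show ?thesis unfolding p_def q_def u_def .
  qed
  finally show ?thesis unfolding Bw2 b_def R_def .
qed

text \<open>The right-hand side of the equation for \<omega>'', with \<open>B\<close> for x sinh
  \<omega> and \<open>r\<close> for \<omega>'. Only y - 1 and x - 1 occur in denominators, and every
  term contains x, y or \<open>B\<close> as a factor.\<close>

definition trig_force :: "complex \<Rightarrow> complex \<Rightarrow> complex \<Rightarrow> complex \<Rightarrow> complex \<Rightarrow> complex" where
  "trig_force \<mu> x y B r =
     (y * r + B * r\<^sup>2 / 4) / (y - 1) - x * r / (x - 1) - B / (4 * (y - 1) * (x - 1))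
       + (2 * \<mu> - 1)\<^sup>2 / 4 * B * (y - 1) / (x - 1)\<^sup>2"

lemma solves_PVI_trigonometric:
  assumes U: "open U"
    and d\<omega>: "\<And>s. s \<in> U \<Longrightarrow> (\<omega> has_field_derivative r s) (at s)"
    and dr: "\<And>s. s \<in> U \<Longrightarrow> (r has_field_derivative
       trig_force \<mu> (exp s) (exp s * (1 + cosh (\<omega> s)) / 2) (exp s * sinh (\<omega> s)) (r s)) (at s)"
  shows "solves_PVI \<mu> (\<lambda>s. exp s * (1 + cosh (\<omega> s)) / 2) U"
  unfolding solves_PVI_def
proof (intro conjI ballI impI)
  let ?y = "\<lambda>s. exp s * (1 + cosh (\<omega> s)) / 2"
  let ?B = "\<lambda>s. exp s * sinh (\<omega> s)"
  have dy: "(?y has_field_derivative ?y s + ?B s * r s / 2) (at s)" if "s \<in> U" for s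
  proof -
    have "((\<lambda>s. cosh (\<omega> s)) has_field_derivative sinh (\<omega> s) * r s) (at s)"
      by (rule has_field_derivative_cosh[OF d\<omega>[OF that]])
    from DERIV_cdivide[OF DERIV_mult[OF DERIV_exp DERIV_add[OF DERIV_const this]], of 1 2]
    show ?thesis by (rule DERIV_cong) (simp add: add_divide_distrib mult_ac)
  qed
  have "?y holomorphic_on U"
    unfolding holomorphic_on_open[OF U] using dy by blast
  then show "?y analytic_on U"
    using U by (simp add: analytic_on_open)
  fix s assume s: "s \<in> U" and "cproj s \<noteq> 1 \<and> ?y s \<noteq> 0 \<and> ?y s \<noteq> 1 \<and> ?y s \<noteq> cproj s"
  then have ne: "exp s \<noteq> 1" "?y s \<noteq> 0" "?y s \<noteq> 1" "?y s \<noteq> exp s"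
    by (auto simp: cproj_def)
  have ddx_y: "ddx ?y z = (?y z + ?B z * r z / 2) / exp z" if "z \<in> U" for z
    using DERIV_imp_deriv[OF dy[OF that]] by (simp add: ddx_def cproj_def)
  define w2 where "w2 = trig_force \<mu> (exp s) (?y s) (?B s) (r s)"
  have "((\<lambda>z. (?y z + ?B z * r z / 2) / exp z) has_field_derivative
     (?B s * r s + (2 * ?y s - exp s) * (r s)\<^sup>2 + ?B s * w2) / (2 * exp s)) (at s)"
  proof -
    \<comment> \<open>The product rule produces x cosh \<omega>, which equals 2 y - x.\<close>
    have dB: "(?B has_field_derivative (?B s + (2 * ?y s - exp s) * r s)) (at s)"
      by (rule DERIV_cong[OF DERIV_mult[OF DERIV_exp has_field_derivative_sinh[OF d\<omega>[OF s]]]])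
         (simp add: field_simps)
    have "((\<lambda>z. (?y z + ?B z * r z / 2) / exp z) has_field_derivative
       ((?y s + ?B s * r s / 2 + ((?B s + (2 * ?y s - exp s) * r s) * r s + w2 * ?B s) / 2) * exp s
         - (?y s + ?B s * r s / 2) * exp s) / (exp s * exp s)) (at s)"
      using DERIV_divide[OF DERIV_add[OF dy[OF s] DERIV_cdivide[OF DERIV_mult[OF dB dr[OF s, folded w2_def]]]] DERIV_exp, of 2]
      by simp
    then show ?thesis
      by (rule DERIV_cong) (simp add: divide_simps power2_eq_square, simp add: algebra_simps)
  qed
  then have "(ddx ?y has_field_derivative
     (?B s * r s + (2 * ?y s - exp s) * (r s)\<^sup>2 + ?B s * w2) / (2 * exp s)) (at s)"
    by (rule has_field_derivative_transform_within_open[OF _ U s]) (simp add: ddx_y)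
  from DERIV_imp_deriv[OF this]
  have "ddx (ddx ?y) s = (?B s * r s + (2 * ?y s - exp s) * (r s)\<^sup>2 + ?B s * w2) / (2 * (exp s)\<^sup>2)"
    by (subst ddx_def) (simp add: cproj_def power2_eq_square)
  also have "\<dots> = PVI_rhs \<mu> (exp s) (?y s) ((?y s + ?B s * r s / 2) / exp s)"
  proof (rule PVI_rhs_trigonometric[symmetric])
    have "(?B s)\<^sup>2 = (exp s)\<^sup>2 * ((cosh (\<omega> s))\<^sup>2 - 1)"
      by (simp add: power_mult_distrib cosh_square_eq)
    also have "\<dots> = 4 * ?y s * (?y s - exp s)"
      by (simp add: power2_eq_square field_simps)
    finally show "(?B s)\<^sup>2 = 4 * ?y s * (?y s - exp s)" .
  qed (use ne in \<open>simp_all add: w2_def trig_force_def\<close>)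
  finally show "ddx (ddx ?y) s = PVI_rhs \<mu> (cproj s) (?y s) (ddx ?y s)"
    using ddx_y[OF s] by (simp add: cproj_def)
qed

section \<open>Estimates for the transformed equation\<close>

text \<open>The two exponentials are bounded separately, since in the application they are multiples
  of x^(1+\<sigma>) and x^(1-\<sigma>), small for different reasons. The perturbation
  \<open>w\<close> costs at most e^2 < 8.\<close>

lemma norm_cosh_sinh_le:
  fixes x \<zeta> w :: complex
  assumes "cmod (x * exp \<zeta>) \<le> \<rho>" "cmod (x * exp (- \<zeta>)) \<le> \<rho>" "cmod w \<le> 2"
  shows "cmod (x * cosh (\<zeta> + w)) \<le> 8 * \<rho>" "cmod (x * sinh (\<zeta> + w)) \<le> 8 * \<rho>"
proof -
  have e8: "cmod (exp v) \<le> 8" if "cmod v \<le> 2" for v :: complex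
  proof -
    have "cmod (exp v) \<le> exp 2"
      using norm_exp[of v] that by (meson exp_le_cancel_iff order_trans)
    also have "exp 2 = exp 1 * exp (1::real)" by (simp flip: exp_add)
    also have "\<dots> \<le> (272/100) * (272/100)"
      using e_less_272 by (intro mult_mono) auto
    finally show ?thesis by simp
  qed
  have 1: "cmod (x * exp \<zeta> * exp w) \<le> \<rho> * 8"
    using assms e8[of w] order_trans[OF norm_ge_zero assms(1)] unfolding norm_mult by (intro mult_mono) (auto simp: norm_mult)
  have 2: "cmod (x * exp (- \<zeta>) * exp (- w)) \<le> \<rho> * 8"
    using assms e8[of "- w"] order_trans[OF norm_ge_zero assms(1)] unfolding norm_mult by (intro mult_mono) (auto simp: norm_mult)
  have c: "x * cosh (\<zeta> + w) = (x * exp \<zeta> * exp w + x * exp (- \<zeta>) * exp (- w)) / 2"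
    by (simp add: cosh_field_def exp_add exp_diff exp_minus field_simps)
  have s: "x * sinh (\<zeta> + w) = (x * exp \<zeta> * exp w - x * exp (- \<zeta>) * exp (- w)) / 2"
    by (simp add: sinh_field_def exp_add exp_diff exp_minus field_simps)
  show "cmod (x * cosh (\<zeta> + w)) \<le> 8 * \<rho>"
    unfolding c using norm_triangle_ineq[of "x * exp \<zeta> * exp w" "x * exp (- \<zeta>) * exp (- w)"] 1 2
    by (simp add: norm_divide)
  show "cmod (x * sinh (\<zeta> + w)) \<le> 8 * \<rho>"
    unfolding s using norm_triangle_ineq4[of "x * exp \<zeta> * exp w" "x * exp (- \<zeta>) * exp (- w)"] 1 2
    by (simp add: norm_divide)
qed

text \<open>For \<rho> at most 1/16 both x and y have modulus at most 1/2, so each denominator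
  factor is at least 1/2 in modulus and costs a factor 2. The bounds 5 \<rho> and 8 \<rho> are those
  provided by \<open>norm_cosh_sinh_le\<close>.\<close>

lemma norm_trig_force_le:
  assumes "cmod x \<le> \<rho>" "cmod y \<le> 5 * \<rho>" "cmod B \<le> 8 * \<rho>" "\<rho> \<le> 1 / 16" "cmod r \<le> R"
  shows "cmod (trig_force \<mu> x y B r) \<le> (12 * R + 4 * R\<^sup>2 + 8 + 16 * cmod ((2 * \<mu> - 1)\<^sup>2)) * \<rho>"
proof -
  define \<kappa> where "\<kappa> = cmod ((2 * \<mu> - 1)\<^sup>2)"
  have \<rho>: "0 \<le> \<rho>" using assms(1) norm_ge_zero order_trans by blast
  have R: "0 \<le> R" using assms(5) norm_ge_zero order_trans by blast
  have half: "1 / 2 \<le> cmod (u - 1)" if "cmod u \<le> 1 / 2" for u :: complex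
    using norm_triangle_ineq2[of 1 u] that by (simp add: norm_minus_commute)
  have y1: "1 / 2 \<le> cmod (y - 1)" and x1: "1 / 2 \<le> cmod (x - 1)"
    using assms(1,2,4) by (intro half; linarith)+
  have y2: "cmod (y - 1) \<le> 2"
    using norm_triangle_ineq4[of y 1] assms by simp
  have quot: "cmod (n / d) \<le> 2 * b" if "1 / 2 \<le> cmod d" "cmod n \<le> b" for n d :: complex and b :: real
  proof -
    have "cmod (n / d) \<le> b / (1 / 2)"
      unfolding norm_divide using that order_trans[OF norm_ge_zero that(2)] by (intro frac_le) auto
    then show ?thesis by simp
  qed
  have r2: "cmod (r\<^sup>2) \<le> R\<^sup>2" using assms(5) by (simp add: norm_power power_mono)
  have t1: "cmod ((y * r + B * r\<^sup>2 / 4) / (y - 1)) \<le> 2 * (5 * \<rho> * R + 8 * \<rho> * R\<^sup>2 / 4)"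
  proof (rule quot[OF y1])
    have "cmod (y * r) \<le> 5 * \<rho> * R" unfolding norm_mult using assms \<rho> by (intro mult_mono) auto
    moreover have "cmod (B * r\<^sup>2) \<le> 8 * \<rho> * R\<^sup>2" unfolding norm_mult[of B] using assms \<rho> r2 by (intro mult_mono) auto
    then have "cmod (B * r\<^sup>2 / 4) \<le> 8 * \<rho> * R\<^sup>2 / 4" unfolding norm_divide by simp
    ultimately show "cmod (y * r + B * r\<^sup>2 / 4) \<le> 5 * \<rho> * R + 8 * \<rho> * R\<^sup>2 / 4"
      using norm_triangle_ineq[of "y * r" "B * r\<^sup>2 / 4"] by linarith
  qed
  have t2: "cmod (x * r / (x - 1)) \<le> 2 * (\<rho> * R)"
    by (rule quot[OF x1]) (unfold norm_mult, intro mult_mono, use assms \<rho> in auto)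
  have t3: "cmod (B / (4 * (y - 1) * (x - 1))) \<le> 2 * (2 * (8 * \<rho> / 4))"
  proof -
    have "cmod (B / 4 / (y - 1) / (x - 1)) \<le> 2 * (2 * (8 * \<rho> / 4))"
      using assms(3) by (intro quot x1 y1) (simp add: norm_divide)
    then show ?thesis by (simp add: mult_ac)
  qed
  have t4: "cmod ((2 * \<mu> - 1)\<^sup>2 / 4 * B * (y - 1) / (x - 1)\<^sup>2) \<le> 2 * (2 * (\<kappa> / 4 * (8 * \<rho>) * 2))"
  proof -
    have "cmod ((2 * \<mu> - 1)\<^sup>2 / 4 * B) \<le> \<kappa> / 4 * (8 * \<rho>)"
      unfolding norm_mult[of _ B] norm_divide \<kappa>_def[symmetric] using assms by (intro mult_mono) (auto simp: \<kappa>_def)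
    then have "cmod ((2 * \<mu> - 1)\<^sup>2 / 4 * B * (y - 1)) \<le> \<kappa> / 4 * (8 * \<rho>) * 2"
      unfolding norm_mult[of _ "y - 1"] using y2 \<rho> by (intro mult_mono) (auto simp: \<kappa>_def)
    then have "cmod ((2 * \<mu> - 1)\<^sup>2 / 4 * B * (y - 1) / (x - 1) / (x - 1)) \<le> 2 * (2 * (\<kappa> / 4 * (8 * \<rho>) * 2))"
      by (intro quot x1)
    then show ?thesis by (simp only: power2_eq_square divide_divide_eq_left)
  qed
  have tri: "cmod (a1 - a2 - a3 + a4) \<le> cmod a1 + cmod a2 + cmod a3 + cmod a4" for a1 a2 a3 a4 :: complex
    using norm_triangle_ineq[of "a1 - a2 - a3" a4] norm_triangle_ineq4[of "a1 - a2" a3] norm_triangle_ineq4[of a1 a2]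
    by linarith
  have "cmod (trig_force \<mu> x y B r) \<le> 2 * (5 * \<rho> * R + 8 * \<rho> * R\<^sup>2 / 4) + 2 * (\<rho> * R) + 2 * (2 * (8 * \<rho> / 4))
          + 2 * (2 * (\<kappa> / 4 * (8 * \<rho>) * 2))"
    unfolding trig_force_def by (rule order_trans[OF tri]) (intro add_mono t1 t2 t3 t4)
  also have "\<dots> = (12 * R + 4 * R\<^sup>2 + 8 + 16 * \<kappa>) * \<rho>" by (simp add: algebra_simps)
  finally show ?thesis by (simp add: \<kappa>_def)
qed

lemma holomorphic_on_trig_force:
  assumes "x holomorphic_on T" "y holomorphic_on T" "B holomorphic_on T" "r holomorphic_on T"
    and "\<And>z. z \<in> T \<Longrightarrow> x z \<noteq> 1" "\<And>z. z \<in> T \<Longrightarrow> y z \<noteq> 1"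
  shows "(\<lambda>z. trig_force \<mu> (x z) (y z) (B z) (r z)) holomorphic_on T"
  unfolding trig_force_def by (intro holomorphic_intros assms) (use assms(5,6) in auto)

lemma norm_exp_minus_1_le:
  assumes "cmod w \<le> 1"
  shows "cmod (exp w - 1) \<le> 3 * cmod w"
proof -
  have "cmod (exp w - exp 0) \<le> 3 * cmod (w - 0)"
  proof (rule field_differentiable_bound[where f' = exp])
    show "convex (cball (0::complex) 1)" by simp
    show "cmod (exp z) \<le> 3" if "z \<in> cball 0 1" for z :: complex
    proof -
      have "cmod (exp z) \<le> exp (cmod z)" by (rule norm_exp)
      also have "\<dots> \<le> exp 1" using that by simp
      also have "\<dots> \<le> 3" by (rule exp_le)
      finally show ?thesis .
    qed
  qed (use assms in \<open>auto intro!: derivative_eq_intros\<close>)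
  then show ?thesis by simp
qed

section \<open>The leading profile and the solution near zero\<close>

text \<open>Expanding gives exp(-w) + 2 z + exp(w) z^2: the middle term is unaffected by w, and the
  outer ones change by at most 3 |w| each, relative to w = 0.\<close>

lemma square_perturbation:
  assumes "cmod w \<le> 1"
  shows "cmod (exp (- w) * (1 + exp w * z)\<^sup>2 - (1 + z)\<^sup>2) \<le> 3 * (1 + (cmod z)\<^sup>2) * cmod w"
proof -
  have "exp (- w) * (1 + exp w * z)\<^sup>2 - (1 + z)\<^sup>2 = (exp (- w) - 1) + (exp w - 1) * z\<^sup>2"
    by (simp add: exp_minus power2_eq_square field_simps)
  also have "cmod \<dots> \<le> 3 * cmod (- w) + 3 * cmod w * (cmod z)\<^sup>2"
    by (rule order_trans[OF norm_triangle_ineq], unfold norm_mult norm_power, intro add_mono mult_right_mono)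
       (use norm_exp_minus_1_le[of w] norm_exp_minus_1_le[of "- w"] assms in auto)
  finally show ?thesis by (simp add: algebra_simps)
qed

text \<open>From (1 + cosh u)/2 = exp(-u) (1 + exp u)^2 / 4: the factor x^\<sigma> left over from x
  x^(\<sigma>-1) cancels the x^(-\<sigma>) contained in exp(-u).\<close>

lemma trig_profile:
  "exp s * (1 + cosh (\<sigma> * s + c + w)) / 2 * cpow s (\<sigma> - 1)
     = exp (- c) / 4 * (exp (- w) * (1 + exp w * exp (\<sigma> * s + c))\<^sup>2)"
proof -
  have cosh: "(1 + cosh u) / 2 = exp (- u) * (1 + exp u)\<^sup>2 / 4" for u :: complex
    by (simp add: cosh_field_def exp_minus power2_eq_square field_simps)
  have "exp s * (1 + cosh (\<sigma> * s + c + w)) / 2 * cpow s (\<sigma> - 1)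
      = exp (\<sigma> * s) * ((1 + cosh (\<sigma> * s + c + w)) / 2)"
    by (simp add: cpow_def algebra_simps exp_diff)
  also have "\<dots> = exp (- c) / 4 * (exp (- w) * (1 + exp w * exp (\<sigma> * s + c))\<^sup>2)"
  proof -
    have "exp (\<sigma> * s) * exp (- (\<sigma> * s + c + w)) = exp (- c) * exp (- w)"
      by (simp flip: exp_add)
    moreover have "exp (\<sigma> * s + c + w) = exp w * exp (\<sigma> * s + c)"
      by (simp flip: exp_add add: algebra_simps)
    ultimately show ?thesis unfolding cosh by (simp add: mult.assoc[symmetric])
  qed
  finally show ?thesis .
qed

text \<open>The force in the equation for \<omega> is of order |x|^(2q). Far to the left one factor
  |x|^q is spent on smallness for the Picard iteration and the other remains as decay of the
  correction w. The profile identity then converts |w| \<le> |x|^q into the error bound for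
  y.\<close>

lemma PVI_solution_near_zero:
  fixes \<mu> \<sigma> c d :: complex
  assumes U: "open U" "convex U" "\<And>s t. \<lbrakk>s \<in> U; 0 \<le> t\<rbrakk> \<Longrightarrow> s - of_real t * d \<in> U"
    and d: "Re d = 1" and q: "0 < q" "2 * q \<le> 1" and M: "0 \<le> M"
    and bound: "\<And>s. \<lbrakk>s \<in> U; Re s \<le> 0\<rbrakk> \<Longrightarrow> cmod (cpow s \<sigma>) \<le> M"
      "\<And>s. \<lbrakk>s \<in> U; Re s \<le> 0\<rbrakk> \<Longrightarrow> cmod (cpow s (1 - \<sigma>)) \<le> M * exp (2 * q * Re s)"
  shows "\<exists>L y Q. L \<le> 0 \<and> 0 \<le> Q \<and> solves_PVI \<mu> y (U \<inter> {s. Re s < L}) \<and>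
    (\<forall>s\<in>U. Re s < L \<longrightarrow>
       cmod (y s * cpow s (\<sigma> - 1) - exp (- c) / 4 * (1 + exp (\<sigma> * s + c))\<^sup>2) \<le> Q * exp (q * Re s))"
proof -
  \<comment> \<open>With this constant |x|, |x^(1+\<sigma>) e^c| and |x^(1-\<sigma>) e^(-c)| are all
    at most \<open>C0\<close> |x|^(2q).\<close>
  define C0 where "C0 = 1 + M * exp (Re c) + M * exp (- Re c)"
  \<comment> \<open>Bounds \<omega>' = \<sigma> + p for all |p| < 2, the range in which the
    iteration lemma needs the force.\<close>
  define R where "R = cmod \<sigma> + 2"
  define Cf where "Cf = 12 * R + 4 * R\<^sup>2 + 8 + 16 * cmod ((2 * \<mu> - 1)\<^sup>2)"
  \<comment> \<open>This is the value of |x|^q at Re s = \<open>L\<close>. The first entry keeps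
    \<rho> at most 1/16, the second is the contraction condition with
    \<open>m = Cf * (C0 * \<eta>)\<close>.\<close>
  define \<eta> where "\<eta> = min (1 / (16 * C0)) (1 / (4 * (cmod d / q)\<^sup>2 * Cf * C0))"
  define L where "L = ln \<eta> / q"
  define V where "V = U \<inter> {s. Re s < L}"
  have C0: "1 \<le> C0" using M by (simp add: C0_def)
  have Cf: "0 < Cf" by (simp add: Cf_def R_def add_nonneg_pos add_pos_nonneg)
  have "d \<noteq> 0" using d by auto
  then have "0 < \<eta>" using C0 Cf q by (simp add: \<eta>_def)
  have \<eta>1: "C0 * \<eta> \<le> 1 / 16"
  proof -
    have "C0 * \<eta> \<le> C0 * (1 / (16 * C0))" using C0 by (intro mult_left_mono) (auto simp: \<eta>_def)
    then show ?thesis using C0 by simp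
  qed
  have "1 * \<eta> \<le> C0 * \<eta>" using C0 \<open>0 < \<eta>\<close> by (intro mult_right_mono) auto
  then have \<eta>_le: "\<eta> \<le> 1 / 16" using \<eta>1 by simp
  have \<eta>2: "4 * (cmod d / q)\<^sup>2 * (Cf * (C0 * \<eta>)) \<le> 1"
  proof -
    define X where "X = 4 * (cmod d / q)\<^sup>2 * Cf * C0"
    have pos: "0 < X" using C0 Cf q \<open>d \<noteq> 0\<close> by (simp add: X_def)
    have "\<eta> \<le> 1 / X" unfolding \<eta>_def X_def by simp
    then have "X * \<eta> \<le> 1" using pos by (simp add: field_simps)
    then show ?thesis by (simp add: X_def mult.assoc)
  qed
  have L: "exp (q * L) = \<eta>" "L \<le> 0"
    using q \<open>0 < \<eta>\<close> \<eta>_le by (auto simp: L_def divide_nonpos_pos)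
  interpret V: ray_invariant V d q
  proof
    show "open V" "convex V" unfolding V_def
      by (auto intro!: open_Int convex_Int U open_halfspace_Re_lt convex_halfspace_Re_lt)
    show "s - of_real t * d \<in> V" if "s \<in> V" "0 \<le> t" for s t
      using that U(3)[of s t] d by (simp add: V_def)
    show "Re s \<le> 0" if "s \<in> V" for s using that L(2) by (simp add: V_def)
  qed (use d q in auto)
  define \<rho> where "\<rho> s = C0 * exp (2 * q * Re s)" for s :: complex
  have \<rho>_decay: "\<rho> s \<le> C0 * \<eta> * V.decay s" if "s \<in> V" for s
  proof -
    have "q * Re s \<le> q * L" using that q by (simp add: V_def)
    then have "exp (2 * q * Re s) \<le> exp (q * L + q * Re s)" by simp
    then show ?thesis
      using C0 by (simp add: \<rho>_def V.decay_def exp_add L(1) mult.assoc)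
  qed
  have \<rho>_le: "\<rho> s \<le> 1 / 16" if "s \<in> V" for s
  proof -
    have "C0 * \<eta> * V.decay s \<le> C0 * \<eta> * 1"
      using V.decay_le_1[OF that] C0 \<open>0 < \<eta>\<close> by (intro mult_left_mono) auto
    then show ?thesis using \<rho>_decay[OF that] \<eta>1 by linarith
  qed
  have x_le: "cmod (exp s) \<le> \<rho> s" and plus_le: "cmod (exp s * exp (\<sigma> * s + c)) \<le> \<rho> s"
    and minus_le: "cmod (exp s * exp (- (\<sigma> * s + c))) \<le> \<rho> s" if s: "s \<in> V" for s
  proof -
    have Re_s: "Re s \<le> 0" "s \<in> U" using V.Re_U[OF s] s by (auto simp: V_def)
    define E where "E = exp (2 * q * Re s)"
    \<comment> \<open>The factor x itself decays at least like |x|^(2q), because 2q is at most 1 and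
      Re s is nonpositive.\<close>
    have "1 * Re s \<le> 2 * q * Re s" using Re_s q by (intro mult_right_mono_neg) auto
    then have E: "exp (Re s) \<le> E" "0 \<le> E" by (simp_all add: E_def)
    have "C0 * E = E + E * M * exp (Re c) + M * E * exp (- Re c)"
      by (simp add: C0_def algebra_simps)
    moreover have "0 \<le> E * M * exp (Re c)" "0 \<le> M * E * exp (- Re c)" using M E by auto
    ultimately have C0E: "E \<le> C0 * E" "E * M * exp (Re c) \<le> C0 * E" "M * E * exp (- Re c) \<le> C0 * E"
      using E(2) by linarith+
    have \<rho>E: "\<rho> s = C0 * E" by (simp add: \<rho>_def E_def)
    show "cmod (exp s) \<le> \<rho> s" using C0E(1) E(1) by (simp add: \<rho>E)
    have "cmod (exp s * exp (\<sigma> * s + c)) = cmod (exp s) * cmod (cpow s \<sigma>) * exp (Re c)"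
      unfolding exp_add norm_mult cpow_def by simp
    also have "\<dots> \<le> E * M * exp (Re c)"
      using E bound(1)[OF Re_s(2,1)] M by (intro mult_mono) auto
    finally show "cmod (exp s * exp (\<sigma> * s + c)) \<le> \<rho> s" using C0E(2) by (simp add: \<rho>E)
    have "exp s * exp (- (\<sigma> * s + c)) = cpow s (1 - \<sigma>) * exp (- c)"
      by (simp add: cpow_def algebra_simps flip: exp_add)
    then have "cmod (exp s * exp (- (\<sigma> * s + c))) = cmod (cpow s (1 - \<sigma>)) * exp (- Re c)"
      by (simp add: norm_mult)
    also have "\<dots> \<le> M * E * exp (- Re c)"
      using bound(2)[OF Re_s(2,1)] by (intro mult_right_mono) (auto simp: E_def)
    finally show "cmod (exp s * exp (- (\<sigma> * s + c))) \<le> \<rho> s" using C0E(3) by (simp add: \<rho>E)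
  qed
  define Y where "Y s w = exp s * (1 + cosh (\<sigma> * s + c + w)) / 2" for s w
  define B where "B s w = exp s * sinh (\<sigma> * s + c + w)" for s w
  have B_le: "cmod (B s w) \<le> 8 * \<rho> s" and Y_le: "cmod (Y s w) \<le> 5 * \<rho> s"
    if s: "s \<in> V" and w: "cmod w \<le> 2" for s w
  proof -
    note le = norm_cosh_sinh_le[OF plus_le[OF s] minus_le[OF s] w]
    show "cmod (B s w) \<le> 8 * \<rho> s" using le(2) by (simp add: B_def)
    \<comment> \<open>The constant 5 rounds up (1 + 8)/2.\<close>
    have "Y s w = (exp s + exp s * cosh (\<sigma> * s + c + w)) / 2" by (simp add: Y_def algebra_simps)
    also have "cmod \<dots> \<le> (cmod (exp s) + cmod (exp s * cosh (\<sigma> * s + c + w))) / 2"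
      unfolding norm_divide using norm_triangle_ineq[of "exp s" "exp s * cosh (\<sigma> * s + c + w)"] by simp
    finally have "cmod (Y s w) \<le> (cmod (exp s) + cmod (exp s * cosh (\<sigma> * s + c + w))) / 2" .
    moreover have "A \<le> 5 * r" if "A \<le> (b + h) / 2" "h \<le> 8 * r" "b \<le> r" "0 \<le> b" for A b h r :: real
      using that by (simp add: field_simps)
    ultimately show "cmod (Y s w) \<le> 5 * \<rho> s"
      using le(1) x_le[OF s] norm_ge_zero by blast
  qed
  have x_ne: "exp s \<noteq> 1" if "s \<in> V" for s
  proof -
    have "cmod (exp s) < 1" using x_le[OF that] \<rho>_le[OF that] by linarith
    then show ?thesis by (metis less_irrefl norm_one)
  qed
  have Y_ne: "Y s w \<noteq> 1" if "s \<in> V" "cmod w \<le> 2" for s w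
    using Y_le[OF that] \<rho>_le[OF that(1)] by auto
  define F where "F s w p = trig_force \<mu> (exp s) (Y s w) (B s w) (\<sigma> + p)" for s w p
  have "\<exists>w p. \<forall>s\<in>V. (w has_field_derivative p s) (at s) \<and> (p has_field_derivative F s (w s) (p s)) (at s) \<and>
           cmod (w s) \<le> V.decay s \<and> cmod (p s) \<le> 1"
  proof (rule V.second_order_solution)
    show "(\<lambda>z. F (f z) (g z) (h z)) holomorphic_on T"
      if "open T" "f holomorphic_on T" "g holomorphic_on T" "h holomorphic_on T" "f ` T \<subseteq> V"
         "\<And>z. z \<in> T \<Longrightarrow> cmod (g z) < 2" for T f g h
      unfolding F_def
    proof (rule holomorphic_on_trig_force)
      show "(\<lambda>z. Y (f z) (g z)) holomorphic_on T" "(\<lambda>z. B (f z) (g z)) holomorphic_on T"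
        unfolding Y_def B_def cosh_field_def sinh_field_def by (intro holomorphic_intros that; simp)+
      show "(\<lambda>z. exp (f z)) holomorphic_on T" "(\<lambda>z. \<sigma> + h z) holomorphic_on T"
        by (intro holomorphic_intros that)+
      fix z assume "z \<in> T"
      then have "f z \<in> V" "cmod (g z) \<le> 2" using that(5) that(6)[of z] by auto
      then show "exp (f z) \<noteq> 1" "Y (f z) (g z) \<noteq> 1" using x_ne Y_ne by blast+
    qed
    show "cmod (F s w p) \<le> Cf * (C0 * \<eta>) * V.decay s" if "s \<in> V" "cmod w < 2" "cmod p < 2" for s w p
    proof -
      have "cmod (F s w p) \<le> Cf * \<rho> s"
        unfolding F_def Cf_def
      proof (rule norm_trig_force_le)
        show "cmod (\<sigma> + p) \<le> R" using norm_triangle_ineq[of \<sigma> p] that by (simp add: R_def)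
      qed (use that x_le B_le Y_le \<rho>_le in auto)
      also have "\<dots> \<le> Cf * (C0 * \<eta> * V.decay s)"
        using \<rho>_decay[OF that(1)] Cf by (intro mult_left_mono) auto
      finally show ?thesis by (simp add: mult.assoc)
    qed
    show "4 * V.K\<^sup>2 * (Cf * (C0 * \<eta>)) \<le> 1" using \<eta>2 by (simp add: V.K_def)
    show "0 \<le> Cf * (C0 * \<eta>)" using Cf C0 \<open>0 < \<eta>\<close> by simp
  qed
  then obtain w p where w: "\<And>s. s \<in> V \<Longrightarrow> (w has_field_derivative p s) (at s)"
    and p: "\<And>s. s \<in> V \<Longrightarrow> (p has_field_derivative F s (w s) (p s)) (at s)"
    and w_le: "\<And>s. s \<in> V \<Longrightarrow> cmod (w s) \<le> V.decay s"
    by blast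
  have "solves_PVI \<mu> (\<lambda>s. exp s * (1 + cosh (\<sigma> * s + c + w s)) / 2) V"
  proof (rule solves_PVI_trigonometric[OF V.open_U])
    show "((\<lambda>s. \<sigma> * s + c + w s) has_field_derivative \<sigma> + p s) (at s)" if "s \<in> V" for s
      using w[OF that] by (auto intro!: derivative_eq_intros)
    show "((\<lambda>s. \<sigma> + p s) has_field_derivative trig_force \<mu> (exp s)
        (exp s * (1 + cosh (\<sigma> * s + c + w s)) / 2) (exp s * sinh (\<sigma> * s + c + w s)) (\<sigma> + p s)) (at s)"
      if "s \<in> V" for s
      using DERIV_add[OF DERIV_const p[OF that], of \<sigma>] by (simp add: F_def Y_def B_def)
  qed
  then have solves: "solves_PVI \<mu> (\<lambda>s. Y s (w s)) V" by (simp add: Y_def)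
  define Q where "Q = exp (- Re c) / 4 * (3 * (1 + (M * exp (Re c))\<^sup>2))"
  have "cmod (Y s (w s) * cpow s (\<sigma> - 1) - exp (- c) / 4 * (1 + exp (\<sigma> * s + c))\<^sup>2) \<le> Q * V.decay s"
    if s: "s \<in> V" for s
  proof -
    define z where "z = exp (\<sigma> * s + c)"
    have Re_s: "Re s \<le> 0" "s \<in> U" using V.Re_U[OF s] s by (auto simp: V_def)
    have "cmod z = cmod (cpow s \<sigma>) * exp (Re c)"
      unfolding z_def exp_add norm_mult cpow_def by simp
    also have "\<dots> \<le> M * exp (Re c)" using bound(1)[OF Re_s(2,1)] by simp
    finally have z: "(cmod z)\<^sup>2 \<le> (M * exp (Re c))\<^sup>2" by (intro power_mono) auto
    have "Y s (w s) * cpow s (\<sigma> - 1) - exp (- c) / 4 * (1 + z)\<^sup>2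
        = exp (- c) / 4 * (exp (- w s) * (1 + exp (w s) * z)\<^sup>2 - (1 + z)\<^sup>2)"
      unfolding Y_def trig_profile z_def by (simp add: right_diff_distrib)
    also have "cmod \<dots> = exp (- Re c) / 4 * cmod (exp (- w s) * (1 + exp (w s) * z)\<^sup>2 - (1 + z)\<^sup>2)"
      by (simp add: norm_mult norm_divide)
    also have "\<dots> \<le> exp (- Re c) / 4 * (3 * (1 + (cmod z)\<^sup>2) * cmod (w s))"
      using w_le[OF s] V.decay_le_1[OF s] by (intro mult_left_mono square_perturbation) auto
    also have "\<dots> \<le> exp (- Re c) / 4 * (3 * (1 + (M * exp (Re c))\<^sup>2) * V.decay s)"
      using w_le[OF s] z by (intro mult_left_mono mult_mono) auto
    finally show ?thesis by (simp add: z_def Q_def mult.assoc)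
  qed
  moreover have "0 \<le> Q" by (simp add: Q_def)
  ultimately show ?thesis
    using L(2) solves by (intro exI[of _ L] exI[of _ "\<lambda>s. Y s (w s)"] exI[of _ Q]) (auto simp: V_def V.decay_def)
qed

section \<open>Asymptotics along paths to zero\<close>

lemma solves_PVI_subset: "\<lbrakk>solves_PVI \<mu> y V; D \<subseteq> V\<rbrakk> \<Longrightarrow> solves_PVI \<mu> y D"
  unfolding solves_PVI_def using analytic_on_subset by blast

lemma cpow_inverse: "cpow s (1 - \<sigma>) * cpow s (\<sigma> - 1) = 1"
  by (simp add: cpow_def algebra_simps flip: exp_add)

lemma cabs_powr: "cabs s powr e = exp (e * Re s)"
  by (simp add: cabs_def powr_def)

lemma asymp_along_add_of_bound:
  assumes "\<forall>\<^sub>F t in at_right 0. cmod (y (\<gamma> t) * cpow (\<gamma> t) (\<sigma> - 1) - A (\<gamma> t)) \<le> Q * cabs (\<gamma> t) powr \<delta>"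
  shows "asymp_along_add y A \<sigma> \<delta> \<gamma>"
  unfolding asymp_along_add_def
proof (intro exI conjI)
  let ?h = "\<lambda>t. y (\<gamma> t) * cpow (\<gamma> t) (\<sigma> - 1) - A (\<gamma> t)"
  show "?h \<in> O[at_right 0](\<lambda>t. complex_of_real (cabs (\<gamma> t) powr \<delta>))"
    using assms by (intro bigoI[where c = Q]) simp
  show "\<forall>\<^sub>F t in at_right 0. y (\<gamma> t) = cpow (\<gamma> t) (1 - \<sigma>) * (A (\<gamma> t) + ?h t)"
  proof (intro always_eventually allI)
    fix t
    have "cpow (\<gamma> t) (1 - \<sigma>) * (A (\<gamma> t) + ?h t) = y (\<gamma> t) * (cpow (\<gamma> t) (1 - \<sigma>) * cpow (\<gamma> t) (\<sigma> - 1))"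
      by (simp add: mult_ac)
    then show "y (\<gamma> t) = cpow (\<gamma> t) (1 - \<sigma>) * (A (\<gamma> t) + ?h t)"
      by (simp only: cpow_inverse mult_1_right)
  qed
qed

text \<open>Dividing the additive error by \<open>A\<close> costs only 1/\<alpha>, so an amplitude
  bounded away from zero turns it into a relative error.\<close>

lemma asymp_along_of_bound:
  assumes bound: "\<forall>\<^sub>F t in at_right 0. cmod (y (\<gamma> t) * cpow (\<gamma> t) (\<sigma> - 1) - A (\<gamma> t)) \<le> Q * cabs (\<gamma> t) powr \<delta>"
    and A: "\<forall>\<^sub>F t in at_right 0. \<alpha> \<le> cmod (A (\<gamma> t))" and "0 < \<alpha>"
  shows "asymp_along y A \<sigma> \<delta> \<gamma>"
  unfolding asymp_along_def
proof (intro exI conjI)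
  let ?h = "\<lambda>t. (y (\<gamma> t) * cpow (\<gamma> t) (\<sigma> - 1) - A (\<gamma> t)) / A (\<gamma> t)"
  have "\<forall>\<^sub>F t in at_right 0. cmod (?h t) \<le> Q / \<alpha> * cmod (complex_of_real (cabs (\<gamma> t) powr \<delta>))"
    using bound A
  proof eventually_elim
    case (elim t)
    have "cmod (?h t) \<le> Q * cabs (\<gamma> t) powr \<delta> / \<alpha>"
      unfolding norm_divide using elim \<open>0 < \<alpha>\<close> order_trans[OF norm_ge_zero elim(1)] by (intro frac_le) auto
    then show ?case by simp
  qed
  then show "?h \<in> O[at_right 0](\<lambda>t. complex_of_real (cabs (\<gamma> t) powr \<delta>))"
    by (rule bigoI)
  show "\<forall>\<^sub>F t in at_right 0. y (\<gamma> t) = A (\<gamma> t) * cpow (\<gamma> t) (1 - \<sigma>) * (1 + ?h t)"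
    using A
  proof eventually_elim
    case (elim t)
    then have "A (\<gamma> t) \<noteq> 0" using \<open>0 < \<alpha>\<close> by auto
    then have "A (\<gamma> t) * cpow (\<gamma> t) (1 - \<sigma>) * (1 + ?h t)
        = (cpow (\<gamma> t) (1 - \<sigma>) * cpow (\<gamma> t) (\<sigma> - 1)) * y (\<gamma> t)"
      by (simp add: field_simps)
    then show ?case by (simp add: cpow_inverse)
  qed
qed

section \<open>Spirals, the domain and the amplitude\<close>

lemma Re_spiral: "0 < r \<Longrightarrow> Re (spiral \<sigma> \<Sigma> s0 r) = ln r"
  by (simp add: spiral_def cpoint_def)

lemma cabs_spiral: "0 < r \<Longrightarrow> cabs (spiral \<sigma> \<Sigma> s0 r) = r"
  by (simp add: cabs_def Re_spiral)

text \<open>In exponential form, |x^\<sigma>| = |x_0^\<sigma>| (|x|/|x_0|)^\<Sigma> along the path: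
  \<Sigma> is the exact rate at which x^\<sigma> decays.\<close>

lemma Re_mult_spiral:
  assumes "Im \<sigma> \<noteq> 0" "0 < r"
  shows "Re (\<sigma> * spiral \<sigma> \<Sigma> s0 r) = Re (\<sigma> * s0) + \<Sigma> * (ln r - Re s0)"
  using assms
  by (simp add: spiral_def cpoint_def carg_def cabs_def ln_div) (simp add: field_simps)

text \<open>Taking logarithms makes the conditions on x^\<sigma> affine in s, so they describe
  half-planes.\<close>

lemma mem_dom_nonreal_iff:
  "s \<in> dom_nonreal \<epsilon> \<sigma> \<theta>\<^sub>1 \<theta>\<^sub>2 \<tau> \<longleftrightarrow>
     cabs s < \<epsilon> \<and> - \<theta>\<^sub>1 * Im \<sigma> + \<tau> * Re s \<le> Re (\<sigma> * s) \<and> Re (\<sigma> * s) \<le> - \<theta>\<^sub>2 * Im \<sigma>"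
  unfolding dom_nonreal_def mem_Collect_eq cabs_powr cpow_def norm_exp_eq_Re exp_add[symmetric] exp_le_cancel_iff ..

text \<open>With k = ln(r/|x_0|) \<le> 0, the logarithm of |x^\<sigma>| moves by \<Sigma> k, which
  lies between \<tau> k and 0. The former is the shift of the lower bound, the latter that of the
  upper bound.\<close>

lemma spiral_in_dom_nonreal:
  assumes \<sigma>: "Im \<sigma> \<noteq> 0" and s0: "s0 \<in> dom_nonreal \<epsilon> \<sigma> \<theta>\<^sub>1 \<theta>\<^sub>2 \<tau>" and \<Sigma>: "0 \<le> \<Sigma>" "\<Sigma> \<le> \<tau>"
    and r: "0 < r" "r \<le> cabs s0"
  shows "spiral \<sigma> \<Sigma> s0 r \<in> dom_nonreal \<epsilon> \<sigma> \<theta>\<^sub>1 \<theta>\<^sub>2 \<tau>"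
proof -
  define k where "k = ln r - Re s0"
  have k: "k \<le> 0"
    using r ln_le_cancel_iff[of r "exp (Re s0)"] by (simp add: cabs_def k_def)
  have 1: "- \<theta>\<^sub>1 * Im \<sigma> + \<tau> * Re s0 \<le> Re (\<sigma> * s0)" "Re (\<sigma> * s0) \<le> - \<theta>\<^sub>2 * Im \<sigma>" "cabs s0 < \<epsilon>"
    using s0 unfolding mem_dom_nonreal_iff by blast+
  have "\<tau> * k \<le> \<Sigma> * k" "\<Sigma> * k \<le> 0"
    using \<Sigma> k by (auto intro: mult_right_mono_neg mult_nonneg_nonpos)
  then have "- \<theta>\<^sub>1 * Im \<sigma> + \<tau> * ln r \<le> Re (\<sigma> * s0) + \<Sigma> * k" "Re (\<sigma> * s0) + \<Sigma> * k \<le> - \<theta>\<^sub>2 * Im \<sigma>"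
    using 1 by (simp_all add: k_def algebra_simps)
  then show ?thesis
    unfolding mem_dom_nonreal_iff Re_mult_spiral[OF \<sigma> r(1)] Re_spiral[OF r(1)] cabs_spiral[OF r(1)]
    using 1(3) r by (simp add: k_def)
qed

text \<open>The hypothesis gives x^\<sigma> the polar form with modulus |x_0^\<sigma>|, and the
  three terms then form a perfect square.\<close>

lemma amplitude_zero:
  assumes "cmod (cpow s \<sigma>) = cmod (cpow s0 \<sigma>)" "a \<noteq> 0"
  shows "amplitude \<sigma> a 0 s0 s = a * (1 + cpow s \<sigma> / (4 * a))\<^sup>2"
proof -
  have "cpow s \<sigma> = complex_of_real (cmod (cpow s0 \<sigma>)) * exp (\<i> * of_real (Im (\<sigma> * s)))"
    unfolding assms(1)[symmetric] unfolding cpow_def norm_exp_eq_Re cis_conv_exp[symmetric] by (rule exp_eq_polar)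
  moreover have "exp (2 * \<i> * of_real (Im (\<sigma> * s))) = (exp (\<i> * of_real (Im (\<sigma> * s))))\<^sup>2"
    unfolding mult.assoc by (rule exp_double)
  ultimately show ?thesis
    using assms(2) by (simp add: amplitude_def Let_def power2_eq_square field_simps)
qed

lemma amplitude_bounded: "(\<lambda>r. amplitude \<sigma> a 0 s0 (f r)) \<in> O[F](\<lambda>_. 1)"
proof -
  define \<rho> where "\<rho> = cmod (cpow s0 \<sigma>)"
  have "cmod (amplitude \<sigma> a 0 s0 s) \<le> cmod a * (1 + cmod (1 / (2 * a)) * \<rho> + cmod (1 / (16 * a\<^sup>2)) * \<rho>\<^sup>2)" for s
  proof -
    have e: "cmod (exp (\<i> * of_real t)) = 1" "cmod (exp (2 * \<i> * of_real t)) = 1" for t :: real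
      by simp_all
    define X where "X = 1 / (2 * a) * of_real \<rho> * exp (\<i> * of_real (Im (\<sigma> * s)))"
    define Y where "Y = 1 / (16 * a\<^sup>2) * (of_real \<rho>)\<^sup>2 * exp (2 * \<i> * of_real (Im (\<sigma> * s)))"
    have amp: "amplitude \<sigma> a 0 s0 s = a * (1 + X + Y)"
      by (simp add: amplitude_def Let_def \<rho>_def X_def Y_def)
    have X: "cmod X = cmod (1 / (2 * a)) * \<rho>"
      unfolding X_def norm_mult[of _ "exp _"] e by (simp add: norm_mult norm_divide \<rho>_def)
    have Y: "cmod Y = cmod (1 / (16 * a\<^sup>2)) * \<rho>\<^sup>2"
      unfolding Y_def norm_mult[of _ "exp _"] e by (simp add: norm_mult norm_divide norm_power \<rho>_def)
    have "cmod (1 + X + Y) \<le> 1 + cmod X + cmod Y"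
      using norm_triangle_ineq[of "1 + X" Y] norm_triangle_ineq[of 1 X] by simp
    then show ?thesis
      unfolding amp norm_mult[of a] X Y by (intro mult_left_mono) auto
  qed
  then show ?thesis
    by (intro bigoI[where c = "cmod a * (1 + cmod (1 / (2 * a)) * \<rho> + cmod (1 / (16 * a\<^sup>2)) * \<rho>\<^sup>2)"]) simp
qed

lemma norm_square_minus_1_le:
  assumes "cmod z \<le> Z * e" "0 \<le> e" "e \<le> 1"
  shows "cmod ((1 + z)\<^sup>2 - 1) \<le> (2 * Z + Z\<^sup>2) * e"
proof -
  have "(1 + z)\<^sup>2 - 1 = 2 * z + z\<^sup>2" by (simp add: power2_eq_square algebra_simps)
  also have "cmod \<dots> \<le> 2 * cmod z + (cmod z)\<^sup>2"
    using norm_triangle_ineq[of "2 * z" "z\<^sup>2"] by (simp add: norm_mult norm_power)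
  also have "\<dots> \<le> 2 * (Z * e) + (Z * e)\<^sup>2" using assms by (intro add_mono power_mono) auto
  also have "(Z * e)\<^sup>2 \<le> Z\<^sup>2 * (e * 1)"
    unfolding power_mult_distrib power2_eq_square[of e] using assms by (intro mult_left_mono) auto
  finally show ?thesis by (simp add: algebra_simps)
qed

lemma eventually_small_right: "0 < b \<Longrightarrow> \<forall>\<^sub>F r in at_right (0::real). 0 < r \<and> r \<le> b"
  by (auto simp: eventually_at_right_field)

text \<open>This choice of c matches the profile exp(-c)/4 (1 + exp(\<sigma> s + c))^2 with the
  amplitude a (1 + x^\<sigma>/(4a))^2.\<close>

lemma exp_minus_Ln_4:
  assumes "a \<noteq> 0" and "c = - Ln (4 * a)"
  shows "exp (- c) / 4 = a" "exp (u + c) = exp u / (4 * a)"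
  using assms by (simp_all add: exp_diff)

section \<open>Existence for non-real and for real exponents\<close>

lemma PVI_solution_nonreal:
  fixes \<mu> \<sigma> a :: complex and \<theta>\<^sub>1 \<theta>\<^sub>2 \<tau> :: real
  assumes \<sigma>: "Im \<sigma> \<noteq> 0" and a: "a \<noteq> 0" and \<tau>: "0 < \<tau>" "\<tau> < 1"
  shows "\<exists>\<epsilon>>0. \<exists>\<delta>. 0 < \<delta> \<and> \<delta> < 1 \<and> (\<exists>y.
         solves_PVI \<mu> y (dom_nonreal \<epsilon> \<sigma> \<theta>\<^sub>1 \<theta>\<^sub>2 \<tau>) \<and>
         (\<forall>s0 \<in> dom_nonreal \<epsilon> \<sigma> \<theta>\<^sub>1 \<theta>\<^sub>2 \<tau>. \<forall>\<Sigma>. 0 \<le> \<Sigma> \<and> \<Sigma> \<le> \<tau> \<longrightarrow> spiral_asymp y \<sigma> a \<delta> \<Sigma> s0))"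
proof -
  \<comment> \<open>The two half-planes of the domain are widened by 1 in the exponent, which gives
    an open convex set containing the closed conditions.\<close>
  define U where "U = {s. \<tau> * Re s - Re (\<sigma> * s) < \<theta>\<^sub>1 * Im \<sigma> + 1} \<inter> {s. Re (\<sigma> * s) < - \<theta>\<^sub>2 * Im \<sigma> + 1}"
  \<comment> \<open>Chosen with Re(\<sigma> d) = 0: the ray is the spiral with \<Sigma> = 0, along
    which |x^\<sigma>| is constant, so both half-plane conditions persist.\<close>
  define d where "d = Complex 1 (Re \<sigma> / Im \<sigma>)"
  \<comment> \<open>The lower bound on |x^\<sigma>| makes |x^(1-\<sigma>)| at most a constant times
    |x|^(1-\<tau>), and this exponent is 2q.\<close>
  define q where "q = (1 - \<tau>) / 2"
  define M where "M = exp (\<theta>\<^sub>1 * Im \<sigma> + 1) + exp (- \<theta>\<^sub>2 * Im \<sigma> + 1)"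
  define c where "c = - Ln (4 * a)"
  note c = exp_minus_Ln_4[OF a c_def]
  have "\<exists>L y Q. L \<le> 0 \<and> 0 \<le> Q \<and> solves_PVI \<mu> y (U \<inter> {s. Re s < L}) \<and>
    (\<forall>s\<in>U. Re s < L \<longrightarrow>
       cmod (y s * cpow s (\<sigma> - 1) - exp (- c) / 4 * (1 + exp (\<sigma> * s + c))\<^sup>2) \<le> Q * exp (q * Re s))"
  proof (rule PVI_solution_near_zero)
    show "open U" unfolding U_def by (intro open_Int open_Collect_less continuous_intros)
    have lin: "linear (\<lambda>s. \<tau> * Re s - Re (\<sigma> * s))" "linear (\<lambda>s. Re (\<sigma> * s))"
      by (auto intro!: linearI simp: algebra_simps)
    have "convex (f -` {..<b})" if "linear f" for f :: "complex \<Rightarrow> real" and b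
      using that by (intro convex_linear_vimage) auto
    from convex_Int[OF this[OF lin(1)] this[OF lin(2)]]
    show "convex U" unfolding U_def vimage_def by simp
    show "s - of_real t * d \<in> U" if "s \<in> U" "0 \<le> t" for s t
    proof -
      have "Re (\<sigma> * (s - of_real t * d)) = Re (\<sigma> * s)" "Re (s - of_real t * d) = Re s - t"
        using \<sigma> by (simp_all add: d_def algebra_simps)
      moreover have "\<tau> * (Re s - t) \<le> \<tau> * Re s" using that \<tau> by (intro mult_left_mono) auto
      ultimately show ?thesis using that unfolding U_def by auto
    qed
    show "Re d = 1" by (simp add: d_def)
    show "0 < q" "2 * q \<le> 1" using \<tau> by (simp_all add: q_def)
    show "0 \<le> M" by (simp add: M_def)
    fix s assume s: "s \<in> U" and "Re s \<le> 0"
    have "cmod (cpow s \<sigma>) = exp (Re (\<sigma> * s))" unfolding cpow_def by (rule norm_exp_eq_Re)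
    also have "\<dots> \<le> exp (- \<theta>\<^sub>2 * Im \<sigma> + 1)" using s by (simp add: U_def)
    finally show "cmod (cpow s \<sigma>) \<le> M" unfolding M_def by (smt (verit) exp_gt_zero)
    have "cmod (cpow s (1 - \<sigma>)) = exp (Re ((1 - \<sigma>) * s))" unfolding cpow_def by (rule norm_exp_eq_Re)
    also have "\<dots> \<le> exp (\<theta>\<^sub>1 * Im \<sigma> + 1 + 2 * q * Re s)"
    proof -
      have "Re ((1 - \<sigma>) * s) = Re s - Re (\<sigma> * s)" "2 * q = 1 - \<tau>"
        by (simp add: algebra_simps) (simp add: q_def)
      moreover from this(2) have "2 * q * Re s = Re s - \<tau> * Re s" by (simp only: left_diff_distrib mult_1_left)
      ultimately show ?thesis using s unfolding U_def by simp
    qed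
    also have "\<dots> \<le> M * exp (2 * q * Re s)"
      unfolding exp_add[of _ "2 * q * Re s"] M_def by (intro mult_right_mono) auto
    finally show "cmod (cpow s (1 - \<sigma>)) \<le> M * exp (2 * q * Re s)" .
  qed
  then obtain L y Q where L: "L \<le> 0" "0 \<le> Q" and solves: "solves_PVI \<mu> y (U \<inter> {s. Re s < L})"
    and y: "\<And>s. \<lbrakk>s \<in> U; Re s < L\<rbrakk> \<Longrightarrow>
       cmod (y s * cpow s (\<sigma> - 1) - a * (1 + cpow s \<sigma> / (4 * a))\<^sup>2) \<le> Q * exp (q * Re s)"
    unfolding c cpow_def by blast
  define \<epsilon> where "\<epsilon> = exp L"
  define D where "D = dom_nonreal \<epsilon> \<sigma> \<theta>\<^sub>1 \<theta>\<^sub>2 \<tau>"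
  have D: "D \<subseteq> U \<inter> {s. Re s < L}"
    by (auto simp: D_def mem_dom_nonreal_iff U_def \<epsilon>_def cabs_def)
  have D_le: "Re s \<le> 0" if "s \<in> D" for s using D that L(1) by auto
  have "spiral_asymp y \<sigma> a q \<Sigma> s0" if s0: "s0 \<in> D" and \<Sigma>: "0 \<le> \<Sigma>" "\<Sigma> \<le> \<tau>" for s0 \<Sigma>
  proof -
    let ?\<gamma> = "spiral \<sigma> \<Sigma> s0"
    have "0 < cabs s0" by (simp add: cabs_def)
    then have ev: "\<forall>\<^sub>F r in at_right 0. 0 < r \<and> r \<le> cabs s0" by (rule eventually_small_right)
    have in_D: "?\<gamma> r \<in> D" if "0 < r \<and> r \<le> cabs s0" for r
      using that s0 spiral_in_dom_nonreal[OF \<sigma> _ \<Sigma>] by (simp add: D_def)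
    have main: "cmod (y (?\<gamma> r) * cpow (?\<gamma> r) (\<sigma> - 1) - a * (1 + cpow (?\<gamma> r) \<sigma> / (4 * a))\<^sup>2) \<le> Q * cabs (?\<gamma> r) powr q"
      if "0 < r \<and> r \<le> cabs s0" for r
      using y[of "?\<gamma> r"] in_D[OF that] D by (auto simp: cabs_powr)
    have cpow_le: "cmod (cpow (?\<gamma> r) \<sigma>) = exp (Re (\<sigma> * s0) + \<Sigma> * (ln r - Re s0))" if "0 < r" for r
      unfolding cpow_def norm_exp_eq_Re Re_mult_spiral[OF \<sigma> that] ..
    show ?thesis
    proof (cases "\<Sigma> = 0")
      case True
      have amp: "amplitude \<sigma> a \<Sigma> s0 (?\<gamma> r) = a * (1 + cpow (?\<gamma> r) \<sigma> / (4 * a))\<^sup>2"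
        and const: "cmod (cpow (?\<gamma> r) \<sigma>) = cmod (cpow s0 \<sigma>)" if "0 < r" for r
      proof -
        show "cmod (cpow (?\<gamma> r) \<sigma>) = cmod (cpow s0 \<sigma>)"
          unfolding cpow_le[OF that] unfolding True cpow_def norm_exp_eq_Re by simp
        then show "amplitude \<sigma> a \<Sigma> s0 (?\<gamma> r) = a * (1 + cpow (?\<gamma> r) \<sigma> / (4 * a))\<^sup>2"
          unfolding True by (rule amplitude_zero[OF _ a])
      qed
      have bound: "\<forall>\<^sub>F r in at_right 0. cmod (y (?\<gamma> r) * cpow (?\<gamma> r) (\<sigma> - 1) - amplitude \<sigma> a \<Sigma> s0 (?\<gamma> r))
          \<le> Q * cabs (?\<gamma> r) powr q"
        using ev by eventually_elim (use amp main in auto)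
      show ?thesis
      proof (cases "cmod (cpow s0 \<sigma>) = 4 * cmod a")
        case False
        \<comment> \<open>This is the constant modulus of z = x^\<sigma>/(4a) on the path. Unless it
          is 1, |1 + z| \<ge> |1 - k| keeps the amplitude away from zero.\<close>
        define k where "k = cmod (cpow s0 \<sigma>) / (4 * cmod a)"
        have "k \<noteq> 1" using False a by (simp add: k_def field_simps)
        have "\<forall>\<^sub>F r in at_right 0. cmod a * (1 - k)\<^sup>2 \<le> cmod (amplitude \<sigma> a \<Sigma> s0 (?\<gamma> r))"
          using ev
        proof eventually_elim
          case (elim r)
          define z where "z = cpow (?\<gamma> r) \<sigma> / (4 * a)"
          have "cmod z = k" unfolding z_def k_def norm_divide const[OF conjunct1[OF elim]] by (simp add: norm_mult)
          then have "\<bar>1 - k\<bar> \<le> cmod (1 + z)"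
            using norm_triangle_ineq3[of 1 "- z"] by simp
          then have "(1 - k)\<^sup>2 \<le> (cmod (1 + z))\<^sup>2" using abs_le_square_iff[of "1 - k" "cmod (1 + z)"] by simp
          then show ?case
            unfolding amp[OF conjunct1[OF elim]] z_def[symmetric] by (simp add: norm_mult norm_power mult_left_mono)
        qed
        moreover have "0 < cmod a * (1 - k)\<^sup>2" using a \<open>k \<noteq> 1\<close> by simp
        ultimately have "asymp_along y (amplitude \<sigma> a \<Sigma> s0) \<sigma> q ?\<gamma>"
          by (rule asymp_along_of_bound[OF bound])
        then show ?thesis using True False by (simp add: spiral_asymp_def)
      qed (use True asymp_along_add_of_bound[OF bound] in \<open>simp add: spiral_asymp_def\<close>)
    next
      case False
      \<comment> \<open>Now |z| is exactly \<open>Z\<close> r^\<Sigma>. The amplitude a drops 2z +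
        z^2 from the profile, so the error exponent becomes the minimum of q and \<Sigma>.\<close>
      define Z where "Z = exp (Re (\<sigma> * s0) - \<Sigma> * Re s0) / (4 * cmod a)"
      define \<delta> where "\<delta> = min q \<Sigma>"
      have "\<forall>\<^sub>F r in at_right 0. cmod (y (?\<gamma> r) * cpow (?\<gamma> r) (\<sigma> - 1) - amplitude \<sigma> a \<Sigma> s0 (?\<gamma> r))
          \<le> (Q + cmod a * (2 * Z + Z\<^sup>2)) * cabs (?\<gamma> r) powr \<delta>"
        using ev
      proof eventually_elim
        case (elim r)
        then have r: "0 < r" by simp
        define s where "s = ?\<gamma> r"
        define e where "e = exp (\<delta> * ln r)"
        have s: "Re s = ln r" "Re s \<le> 0"
          using Re_spiral[OF r] D_le[OF in_D[OF elim]] by (simp_all add: s_def)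
        have mono: "exp (b * ln r) \<le> e" if "\<delta> \<le> b" for b
          using mult_right_mono_neg[OF that, of "ln r"] s by (simp add: e_def)
        have "e \<le> 1" using s \<tau> \<Sigma> by (auto simp: e_def \<delta>_def q_def intro!: mult_nonneg_nonpos)
        have amp: "amplitude \<sigma> a \<Sigma> s0 s = a" using False by (simp add: amplitude_def)
        define z where "z = cpow s \<sigma> / (4 * a)"
        have "cmod z = Z * exp (\<Sigma> * ln r)"
          unfolding z_def s_def norm_divide cpow_le[OF r]
          by (simp add: Z_def norm_mult algebra_simps exp_add exp_diff)
        also have "\<dots> \<le> Z * e"
          using mono[of \<Sigma>] by (intro mult_left_mono) (auto simp: \<delta>_def Z_def)
        finally have "cmod z \<le> Z * e" .
        from norm_square_minus_1_le[OF this _ \<open>e \<le> 1\<close>]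
        have "cmod (a * ((1 + z)\<^sup>2 - 1)) \<le> cmod a * ((2 * Z + Z\<^sup>2) * e)"
          unfolding norm_mult by (intro mult_left_mono) (auto simp: e_def)
        moreover have "cmod (y s * cpow s (\<sigma> - 1) - a * (1 + z)\<^sup>2) \<le> Q * e"
          using main[OF elim] mult_left_mono[OF mono[of q] L(2)] s(1)
          by (simp add: \<delta>_def cabs_powr z_def flip: s_def)
        moreover have "y s * cpow s (\<sigma> - 1) - a = (y s * cpow s (\<sigma> - 1) - a * (1 + z)\<^sup>2) + a * ((1 + z)\<^sup>2 - 1)"
          by (simp add: algebra_simps)
        ultimately have "cmod (y s * cpow s (\<sigma> - 1) - a) \<le> Q * e + cmod a * ((2 * Z + Z\<^sup>2) * e)"
          by (metis add_mono norm_triangle_le)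
        then show ?case
          unfolding s_def[symmetric] amp cabs_powr s(1) by (simp add: e_def algebra_simps)
      qed
      moreover have "\<forall>\<^sub>F r in at_right 0. cmod a \<le> cmod (amplitude \<sigma> a \<Sigma> s0 (?\<gamma> r))"
        using False by (simp add: amplitude_def)
      ultimately have "asymp_along y (amplitude \<sigma> a \<Sigma> s0) \<sigma> \<delta> ?\<gamma>"
        by (rule asymp_along_of_bound) (use a in simp)
      then show ?thesis using False by (simp add: spiral_asymp_def \<delta>_def)
    qed
  qed
  moreover have "0 < \<epsilon>" "0 < q" "q < 1" using \<tau> by (simp_all add: \<epsilon>_def q_def)
  ultimately show ?thesis using solves_PVI_subset[OF solves D] unfolding D_def by blast
qed

text \<open>For u > 0 the terms with x^\<sigma> in the profile are errors of order |x|^u. For u = 0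
  they do not decay, so c must be chosen such that the constant profile (1 + cosh c)/2 equals
  a.\<close>

lemma PVI_solution_real:
  fixes \<mu> a :: complex and u :: real
  assumes u: "0 \<le> u" "u < 1" and a: "a \<noteq> 0"
  shows "\<exists>\<epsilon>>0. \<exists>\<delta>. 0 < \<delta> \<and> \<delta> < 1 \<and> (\<exists>y. solves_PVI \<mu> y (dom_real \<epsilon>) \<and>
         (\<forall>\<gamma>. path_to_zero \<gamma> (dom_real \<epsilon>) \<longrightarrow> asymp_along y (\<lambda>_. a) (of_real u) \<delta> \<gamma>))"
proof -
  define \<sigma> where "\<sigma> = complex_of_real u"
  define q where "q = (1 - u) / 2"
  define \<delta> where "\<delta> = (if u = 0 then q else min q u)"
  have q: "0 < q" "2 * q \<le> 1" "q < 1" using u by (auto simp: q_def)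
  then have \<delta>: "0 < \<delta>" "\<delta> \<le> q" "\<delta> < 1" using u by (auto simp: \<delta>_def)
  obtain c Z where Z: "0 \<le> Z" and c: "\<And>s. Re s \<le> 0 \<Longrightarrow>
      cmod (exp (- c) / 4 * (1 + exp (\<sigma> * s + c))\<^sup>2 - a) \<le> Z * exp (\<delta> * Re s)"
  proof (cases "u = 0")
    case True
    \<comment> \<open>Since cosh c = cos(i c), this solves cosh c = 2a - 1 for every complex
      a.\<close>
    define c where "c = - \<i> * Arccos (2 * a - 1)"
    have "cosh c = 2 * a - 1" by (simp add: cosh_conv_cos c_def)
    then have "(1 + cosh c) / 2 = a" by simp
    then have "exp (- c) / 4 * (1 + exp c)\<^sup>2 = a"
      by (simp add: cosh_field_def exp_minus power2_eq_square field_simps)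
    then show ?thesis using that[of 0 c] True by (simp add: \<sigma>_def)
  next
    case False
    define c where "c = - Ln (4 * a)"
    note c = exp_minus_Ln_4[OF a c_def]
    define Z where "Z = 1 / (4 * cmod a)"
    show ?thesis
    proof (rule that)
      show "0 \<le> cmod a * (2 * Z + Z\<^sup>2)" by (simp add: Z_def)
      fix s :: complex assume s: "Re s \<le> 0"
      define z where "z = exp (\<sigma> * s) / (4 * a)"
      have "u * Re s \<le> \<delta> * Re s" using s False by (intro mult_right_mono_neg) (auto simp: \<delta>_def)
      then have "exp (u * Re s) \<le> exp (\<delta> * Re s)" by simp
      then have "cmod z \<le> Z * exp (\<delta> * Re s)"
        by (simp add: z_def norm_divide norm_mult Z_def \<sigma>_def divide_right_mono)
      then have "cmod ((1 + z)\<^sup>2 - 1) \<le> (2 * Z + Z\<^sup>2) * exp (\<delta> * Re s)"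
        by (rule norm_square_minus_1_le) (use s \<delta> in \<open>auto simp: mult_nonneg_nonpos\<close>)
      then have "cmod (a * ((1 + z)\<^sup>2 - 1)) \<le> cmod a * ((2 * Z + Z\<^sup>2) * exp (\<delta> * Re s))"
        unfolding norm_mult by (intro mult_left_mono) auto
      then show "cmod (exp (- c) / 4 * (1 + exp (\<sigma> * s + c))\<^sup>2 - a) \<le> cmod a * (2 * Z + Z\<^sup>2) * exp (\<delta> * Re s)"
        unfolding c z_def by (simp add: algebra_simps)
    qed
  qed
  \<comment> \<open>For real \<sigma> the moduli of x^\<sigma> and x^(1-\<sigma>) depend on Re s
    alone: they are |x|^u, at most 1, and |x|^(2q). Hence horizontal rays and the whole plane are
    admissible.\<close>
  have "\<exists>L y Q. L \<le> 0 \<and> 0 \<le> Q \<and> solves_PVI \<mu> y (UNIV \<inter> {s. Re s < L}) \<and>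
    (\<forall>s\<in>UNIV. Re s < L \<longrightarrow>
       cmod (y s * cpow s (\<sigma> - 1) - exp (- c) / 4 * (1 + exp (\<sigma> * s + c))\<^sup>2) \<le> Q * exp (q * Re s))"
  proof (rule PVI_solution_near_zero[where d = 1 and M = 1])
    have "2 * q = 1 - u" by (simp add: q_def)
    then show "cmod (cpow s (1 - \<sigma>)) \<le> 1 * exp (2 * q * Re s)" for s
      by (simp add: cpow_def \<sigma>_def)
  qed (use q u in \<open>auto simp: cpow_def \<sigma>_def mult_nonneg_nonpos\<close>)
  then obtain L y Q where L: "L \<le> 0" "0 \<le> Q" and solves: "solves_PVI \<mu> y {s. Re s < L}"
    and y: "\<And>s. Re s < L \<Longrightarrow>
       cmod (y s * cpow s (\<sigma> - 1) - exp (- c) / 4 * (1 + exp (\<sigma> * s + c))\<^sup>2) \<le> Q * exp (q * Re s)"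
    by auto
  have dom: "dom_real (exp L) = {s. Re s < L}" by (simp add: dom_real_def cabs_def)
  have "asymp_along y (\<lambda>_. a) \<sigma> \<delta> \<gamma>" if \<gamma>: "path_to_zero \<gamma> (dom_real (exp L))" for \<gamma>
  proof (rule asymp_along_of_bound)
    show "\<forall>\<^sub>F t in at_right 0. cmod (y (\<gamma> t) * cpow (\<gamma> t) (\<sigma> - 1) - a) \<le> (Q + Z) * cabs (\<gamma> t) powr \<delta>"
      using eventually_small_right[OF zero_less_one]
    proof eventually_elim
      case (elim t)
      define s where "s = \<gamma> t"
      have "t \<in> {0<..1}" using elim by simp
      then have s: "Re s < L" using \<gamma> unfolding path_to_zero_def dom s_def by blast
      have "q * Re s \<le> \<delta> * Re s" using \<delta> s L by (intro mult_right_mono_neg) auto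
      then have "Q * exp (q * Re s) \<le> Q * exp (\<delta> * Re s)" using L by (intro mult_left_mono) auto
      with y[OF s] c[of s] s L
      have "cmod ((y s * cpow s (\<sigma> - 1) - exp (- c) / 4 * (1 + exp (\<sigma> * s + c))\<^sup>2)
          + (exp (- c) / 4 * (1 + exp (\<sigma> * s + c))\<^sup>2 - a)) \<le> Q * exp (\<delta> * Re s) + Z * exp (\<delta> * Re s)"
        by (intro norm_triangle_le) linarith
      then show ?case
        unfolding s_def[symmetric] cabs_powr by (simp add: algebra_simps)
    qed
  qed (use a in auto)
  then show ?thesis using solves \<delta> exp_gt_zero[of L] unfolding \<sigma>_def dom[symmetric] by blast
qed

text \<open>A single choice of \<epsilon>, \<delta> and y serves all starting points, all \<Sigma>
  and all paths; for a given \<sigma> exactly one of the two implications has a true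
  premise.\<close>

theorem theorem1:
  fixes \<mu> \<sigma> a :: complex and \<theta>\<^sub>1 \<theta>\<^sub>2 \<tau> :: real
  assumes "\<mu> \<noteq> 0"
    and "\<sigma> \<notin> complex_of_real ` ({..<0} \<union> {1..})"
    and "a \<noteq> 0"
    and "0 < \<tau>" and "\<tau> < 1"
  shows "\<exists>\<epsilon>>0. \<exists>\<delta>. 0 < \<delta> \<and> \<delta> < 1 \<and> (\<exists>y.
      (Im \<sigma> \<noteq> 0 \<longrightarrow>
         solves_PVI \<mu> y (dom_nonreal \<epsilon> \<sigma> \<theta>\<^sub>1 \<theta>\<^sub>2 \<tau>) \<and>
         (\<forall>s0 \<in> dom_nonreal \<epsilon> \<sigma> \<theta>\<^sub>1 \<theta>\<^sub>2 \<tau>.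
            (\<forall>\<Sigma>. 0 \<le> \<Sigma> \<and> \<Sigma> \<le> \<tau> \<longrightarrow> spiral_asymp y \<sigma> a \<delta> \<Sigma> s0) \<and>
            (\<lambda>r. amplitude \<sigma> a 0 s0 (spiral \<sigma> 0 s0 r)) \<in> O[at_right 0](\<lambda>_. 1))) \<and>
      (Im \<sigma> = 0 \<longrightarrow>
         solves_PVI \<mu> y (dom_real \<epsilon>) \<and>
         (\<forall>\<gamma>. path_to_zero \<gamma> (dom_real \<epsilon>) \<longrightarrow> asymp_along y (\<lambda>_. a) \<sigma> \<delta> \<gamma>)))"
proof (cases "Im \<sigma> = 0")
  case False
  from PVI_solution_nonreal[OF this assms(3-5), of \<mu> \<theta>\<^sub>1 \<theta>\<^sub>2] show ?thesis
    using False amplitude_bounded by blast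
next
  case True
  then have \<sigma>: "\<sigma> = of_real (Re \<sigma>)" by (simp add: complex_eq_iff)
  have "Re \<sigma> \<notin> {..<0} \<union> {1..}"
  proof
    assume "Re \<sigma> \<in> {..<0} \<union> {1..}"
    from imageI[OF this, of complex_of_real] show False
      unfolding \<sigma>[symmetric] using assms(2) by blast
  qed
  then have "0 \<le> Re \<sigma>" "Re \<sigma> < 1" by auto
  from PVI_solution_real[OF this assms(3), of \<mu>] show ?thesis
    unfolding \<sigma>[symmetric] using True by blast
qed

end
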